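(* Let $K$ be a compact convex subset of $F'$. Then $\mathcal O_K(\mathcal N)=\mathcal O_{K\cap\mathcal P}(\mathcal N)$, where $\mathcal P=\{\lambda\in F':\langle\lambda,\Phi(\zeta)\rangle\ge0\ \ \forall\zeta\in E\}$.
   Context: Setting. $E$ is a complex Hilbert space of finite dimension $n$, $F$ a real Hilbert space of finite dimension $m$, $F'$ its dual, $F_{\mathbb C}$ its complexification, and $\Phi\colon E\times E\to F_{\mathbb C}$ is a hermitian map ($\mathbb C$-linear in the first variable, antilinear in the second, $\Phi(\zeta',\zeta)=\overline{\Phi(\zeta,\zeta')}$). Write $\Phi(\zeta):=\Phi(\zeta,\zeta)\in F$. $\mathcal N:=E\times F$ is the $2$-step nilpotent Lie group with product $(\zeta,x)(\zeta',x')=(\zeta+\zeta',x+x'+2\operatorname{Im}\Phi(\zeta,\zeta'))$; $\mathcal S'(\mathcal N)$ is the space of tempered distributions on the vector space $E\times F$. For $v\in E$, $Z_v$ is the left-invariant vector field on $\mathcal N$ which at $(0,0)$ equals $\frac12(\partial_v-i\partial_{iv})$; $\overline{Z_v}$ is its conjugate. A distribution (or function) $u$ on $\mathcal N$ is CR if $\overline{Z_v}u=0$ for every $v\in E$. $\mathcal F_F$ is the Euclidean Fourier transform, $\mathcal F_F(g)(\lambda)=\int_F g(x)e^{-i\langle\lambda,x\rangle}dx$, extended to tempered distributions; $I\otimes\mathcal F_F\colon\mathcal S'(E\times F)\to\mathcal S'(E\times F')$ is the partial Fourier transform in the $F$ variable. For a compact $K\subseteq F'$, $\mathcal O_K(\mathcal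 N)$ is the space of CR functions $g\in C^\infty(\mathcal N)$ such that there is $k\in\mathbb N$ for which $(1+|\cdot|)^{-k}Xg$ is bounded for every left-invariant differential operator $X$ on $\mathcal N$, and such that $(I\otimes\mathcal F_F)g$ is supported in $E\times K$. *)

theory Defs
  imports "HOL-Analysis.Analysis"
begin

text \<open>Finite-dimensional real Hilbert spaces.  The axioms are those of \<^class>\<open>euclidean_space\<close>
  without the requirement that the orthonormal basis be nonempty, so that the zero space, and in
  particular the case of dimension 0 for either of the spaces below, is not excluded.\<close>

class fd_hilbert = real_inner +
  fixes onb :: "'a set"
  assumes finite_onb: "finite onb"
    and inner_onb: "u \<in> onb \<Longrightarrow> v \<in> onb \<Longrightarrow> inner u v = (if u = v then 1 else 0)"
    and onb_all_zero_iff: "(\<forall>u\<in>onb. inner x u = 0) \<longleftrightarrow> x = 0"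

text \<open>Finite-dimensional complex Hilbert spaces; the complex inner product is linear in the first
  variable, and the underlying real inner product is its real part.  Hence \<^const>\<open>onb\<close> is an
  orthonormal basis of the underlying real space, with twice the complex dimension as
  cardinality.\<close>

class fd_chilbert = fd_hilbert +
  fixes scaleC :: "complex \<Rightarrow> 'a \<Rightarrow> 'a"  (infixr \<open>*\<^sub>C\<close> 75)
    and cinner :: "'a \<Rightarrow> 'a \<Rightarrow> complex"
  assumes scaleC_add_right: "c *\<^sub>C (x + y) = c *\<^sub>C x + c *\<^sub>C y"
    and scaleC_add_left: "(c + d) *\<^sub>C x = c *\<^sub>C x + d *\<^sub>C x"
    and scaleC_scaleC: "c *\<^sub>C (d *\<^sub>C x) = (c * d) *\<^sub>C x"
    and scaleR_scaleC: "scaleR r x = complex_of_real r *\<^sub>C x"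
    and cinner_add_left: "cinner (x + y) z = cinner x z + cinner y z"
    and cinner_scaleC_left: "cinner (c *\<^sub>C x) y = c * cinner x y"
    and cinner_commute: "cinner y x = cnj (cinner x y)"
    and inner_eq_Re_cinner: "inner x y = Re (cinner x y)"

instantiation real :: fd_hilbert
begin
definition onb_real :: "real set" where "onb_real = Basis"
instance
  by standard (simp_all add: onb_real_def)
end

instantiation complex :: fd_chilbert
begin
definition onb_complex :: "complex set" where "onb_complex = Basis"
definition scaleC_complex :: "complex \<Rightarrow> complex \<Rightarrow> complex" where "scaleC_complex c z = c * z"
definition cinner_complex :: "complex \<Rightarrow> complex \<Rightarrow> complex" where "cinner_complex z w = z * cnj w"
instance
proof
  show "finite (onb :: complex set)"
    by (simp add: onb_complex_def)
  show "inner u v = (if u = v then 1 else 0)" if "u \<in> onb" "v \<in> onb" for u v :: complex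
    using that inner_Basis[of u v] by (simp add: onb_complex_def)
  show "(\<forall>u\<in>onb. inner x u = 0) \<longleftrightarrow> x = 0" for x :: complex
    using euclidean_all_zero_iff[of x] by (simp add: onb_complex_def)
qed (auto simp: scaleC_complex_def cinner_complex_def algebra_simps scaleR_conv_of_real
        inner_complex_def)
end

instantiation vec :: (fd_hilbert, finite) fd_hilbert
begin
definition onb_vec :: "('a ^ 'b) set" where "onb_vec = (\<Union>i. \<Union>u\<in>onb. {axis i u})"
instance
proof
  show "finite (onb :: ('a ^ 'b) set)"
    by (simp add: onb_vec_def finite_onb)
  fix u v :: "'a ^ 'b"
  assume "u \<in> onb" and "v \<in> onb"
  moreover have "w \<noteq> 0" if "w \<in> onb" for w :: 'a
    using inner_onb[OF that that] by auto
  ultimately show "inner u v = (if u = v then 1 else 0)"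
    by (auto simp: onb_vec_def inner_axis_axis axis_eq_axis inner_onb)
next
  fix x :: "'a ^ 'b"
  show "(\<forall>u\<in>onb. inner x u = 0) \<longleftrightarrow> x = 0"
    by (simp add: onb_vec_def inner_axis onb_all_zero_iff vec_eq_iff)
qed
end

instantiation vec :: (fd_chilbert, finite) fd_chilbert
begin
definition scaleC_vec :: "complex \<Rightarrow> 'a ^ 'b \<Rightarrow> 'a ^ 'b" where "scaleC_vec c x = (\<chi> i. c *\<^sub>C x $ i)"
definition cinner_vec :: "'a ^ 'b \<Rightarrow> 'a ^ 'b \<Rightarrow> complex"
  where "cinner_vec x y = (\<Sum>i\<in>UNIV. cinner (x $ i) (y $ i))"
instance
proof
  fix x y z :: "'a ^ 'b" and c d :: complex and r :: real
  show "cinner y x = cnj (cinner x y)"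
    by (simp add: cinner_vec_def cnj_sum cinner_commute[symmetric])
  show "inner x y = Re (cinner x y)"
    by (simp add: cinner_vec_def inner_vec_def inner_eq_Re_cinner)
qed (simp_all add: scaleC_vec_def cinner_vec_def vec_eq_iff scaleC_add_right scaleC_add_left
        scaleC_scaleC scaleR_scaleC cinner_add_left cinner_scaleC_left sum.distrib sum_distrib_left)
end

text \<open>Lebesgue measure, by the same formula as the library's \<^const>\<open>lborel\<close>, and Lebesgue measure
  on the dual, transported by the Riesz isometry \<open>x \<mapsto> \<langle>x, \<cdot>\<rangle>\<close>.\<close>

definition hborel :: "'a::fd_hilbert measure" where
  "hborel = distr (\<Pi>\<^sub>M b\<in>onb. lborel) borel (\<lambda>f. \<Sum>b\<in>onb. f b *\<^sub>R b)"

definition dual_hborel :: "('a::fd_hilbert \<Rightarrow>\<^sub>L real) measure" where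
  "dual_hborel = distr hborel borel blinfun_inner_right"

subsection \<open>Smooth functions and linear differential operators\<close>

fun iter_deriv :: "'a list \<Rightarrow> ('a::real_normed_vector \<Rightarrow> complex) \<Rightarrow> 'a \<Rightarrow> complex" where
  "iter_deriv [] f = f"
| "iter_deriv (v # vs) f = (\<lambda>p. frechet_derivative (iter_deriv vs f) (at p) v)"

text \<open>\<open>C\<^sup>\<infinity>\<close> on a finite-dimensional space: all iterated directional derivatives exist and are
  differentiable (hence continuous).\<close>

definition smooth :: "('a::real_normed_vector \<Rightarrow> complex) \<Rightarrow> bool" where
  "smooth f \<longleftrightarrow> (\<forall>vs p. iter_deriv vs f differentiable (at p))"

text \<open>Finite order and smooth complex coefficients.  Only the values on smooth functions matter.\<close>

definition linear_diff_op :: "(('a::real_normed_vector \<Rightarrow> complex) \<Rightarrow> 'a \<Rightarrow> complex) \<Rightarrow> bool" where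
  "linear_diff_op D \<longleftrightarrow>
     (\<exists>(N::nat) a vs. (\<forall>j<N. smooth (a j)) \<and>
        (\<forall>f. smooth f \<longrightarrow> D f = (\<lambda>p. \<Sum>j<N. a j p * iter_deriv (vs j) f p)))"

subsection \<open>Hermitian maps and the nilpotent group\<close>

text \<open>The complexification of \<open>F\<close> is \<open>F \<times> F\<close>, the pair \<open>(a, b)\<close> standing for \<open>a + i b\<close>.\<close>

type_synonym 'f complexification = "'f \<times> 'f"

definition cscale :: "complex \<Rightarrow> 'f::real_vector complexification \<Rightarrow> 'f complexification" where
  "cscale c z = (Re c *\<^sub>R fst z - Im c *\<^sub>R snd z, Re c *\<^sub>R snd z + Im c *\<^sub>R fst z)"

definition cconj :: "'f::real_vector complexification \<Rightarrow> 'f complexification" where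
  "cconj z = (fst z, - snd z)"

definition hermitian_map ::
  "('e::fd_chilbert \<Rightarrow> 'e \<Rightarrow> 'f::fd_hilbert complexification) \<Rightarrow> bool" where
  "hermitian_map \<Phi> \<longleftrightarrow>
     (\<forall>x y z. \<Phi> (x + y) z = \<Phi> x z + \<Phi> y z) \<and>
     (\<forall>c x z. \<Phi> (c *\<^sub>C x) z = cscale c (\<Phi> x z)) \<and>
     (\<forall>x y z. \<Phi> x (y + z) = \<Phi> x y + \<Phi> x z) \<and>
     (\<forall>c x z. \<Phi> x (c *\<^sub>C z) = cscale (cnj c) (\<Phi> x z)) \<and>
     (\<forall>x y. \<Phi> y x = cconj (\<Phi> x y))"

text \<open>\<open>\<Phi>(\<zeta>) = \<Phi>(\<zeta>, \<zeta>)\<close>, whose imaginary part vanishes for hermitian \<open>\<Phi>\<close>.\<close>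

definition hquad :: "('e \<Rightarrow> 'e \<Rightarrow> 'f complexification) \<Rightarrow> 'e \<Rightarrow> 'f" where
  "hquad \<Phi> \<zeta> = fst (\<Phi> \<zeta> \<zeta>)"

definition polar_cone ::
  "('e::fd_chilbert \<Rightarrow> 'e \<Rightarrow> 'f::fd_hilbert complexification) \<Rightarrow> ('f \<Rightarrow>\<^sub>L real) set" where
  "polar_cone \<Phi> = {\<xi>. \<forall>\<zeta>. blinfun_apply \<xi> (hquad \<Phi> \<zeta>) \<ge> 0}"

definition nmult ::
  "('e::fd_chilbert \<Rightarrow> 'e \<Rightarrow> 'f::fd_hilbert complexification) \<Rightarrow> 'e \<times> 'f \<Rightarrow> 'e \<times> 'f \<Rightarrow> 'e \<times> 'f" where
  "nmult \<Phi> p q = (fst p + fst q, snd p + snd q + 2 *\<^sub>R snd (\<Phi> (fst p) (fst q)))"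

text \<open>The left-invariant vector field with value \<open>w\<close> at the identity \<open>(0, 0)\<close>: differentiate the
  left translate of \<open>f\<close> by \<open>p\<close> at the identity, in the direction \<open>w\<close>.\<close>

definition left_field ::
  "('e::fd_chilbert \<Rightarrow> 'e \<Rightarrow> 'f::fd_hilbert complexification) \<Rightarrow> 'e \<times> 'f \<Rightarrow>
     ('e \<times> 'f \<Rightarrow> complex) \<Rightarrow> 'e \<times> 'f \<Rightarrow> complex" where
  "left_field \<Phi> w f p = frechet_derivative (\<lambda>q. f (nmult \<Phi> p q)) (at 0) w"

definition Zbar ::
  "('e::fd_chilbert \<Rightarrow> 'e \<Rightarrow> 'f::fd_hilbert complexification) \<Rightarrow> 'e \<Rightarrow>
     ('e \<times> 'f \<Rightarrow> complex) \<Rightarrow> 'e \<times> 'f \<Rightarrow> complex" where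
  "Zbar \<Phi> v f p = (left_field \<Phi> (v, 0) f p + \<i> * left_field \<Phi> (\<i> *\<^sub>C v, 0) f p) / 2"

definition left_invariant_diff_op ::
  "('e::fd_chilbert \<Rightarrow> 'e \<Rightarrow> 'f::fd_hilbert complexification) \<Rightarrow>
     (('e \<times> 'f \<Rightarrow> complex) \<Rightarrow> 'e \<times> 'f \<Rightarrow> complex) \<Rightarrow> bool" where
  "left_invariant_diff_op \<Phi> D \<longleftrightarrow> linear_diff_op D \<and>
     (\<forall>f q. smooth f \<longrightarrow> D (\<lambda>p. f (nmult \<Phi> q p)) = (\<lambda>p. D f (nmult \<Phi> q p)))"

subsection \<open>Partial Fourier transform and support\<close>

definition fun_distribution ::
  "('e::fd_chilbert \<times> 'f::fd_hilbert \<Rightarrow> complex) \<Rightarrow> ('e \<times> 'f \<Rightarrow> complex) \<Rightarrow> complex" where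
  "fun_distribution g \<phi> = (\<integral>p. g p * \<phi> p \<partial>(hborel \<Otimes>\<^sub>M hborel))"

definition partial_fourier_test ::
  "('e::fd_chilbert \<times> ('f::fd_hilbert \<Rightarrow>\<^sub>L real) \<Rightarrow> complex) \<Rightarrow> 'e \<times> 'f \<Rightarrow> complex" where
  "partial_fourier_test \<phi> p =
     (\<integral>\<xi>. \<phi> (fst p, \<xi>) * exp (- \<i> * of_real (blinfun_apply \<xi> (snd p))) \<partial>dual_hborel)"

text \<open>Extension of \<open>I \<otimes> \<F>\<^sub>F\<close> to tempered distributions by transposition.  The Fourier kernel is
  symmetric in \<open>x\<close> and \<open>\<xi>\<close>, so the transpose is the Fourier transform in \<open>\<xi>\<close>.\<close>

definition partial_fourier ::
  "(('e::fd_chilbert \<times> 'f::fd_hilbert \<Rightarrow> complex) \<Rightarrow> complex) \<Rightarrow>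
     ('e \<times> ('f \<Rightarrow>\<^sub>L real) \<Rightarrow> complex) \<Rightarrow> complex" where
  "partial_fourier u \<phi> = u (partial_fourier_test \<phi>)"

text \<open>The support is the complement of the largest open set on which the distribution vanishes.\<close>

definition distribution_support ::
  "(('a::real_normed_vector \<Rightarrow> complex) \<Rightarrow> complex) \<Rightarrow> 'a set" where
  "distribution_support T =
     - \<Union>{U. open U \<and>
          (\<forall>\<phi>. smooth \<phi> \<and> compact (closure {p. \<phi> p \<noteq> 0}) \<and> closure {p. \<phi> p \<noteq> 0} \<subseteq> U
                \<longrightarrow> T \<phi> = 0)}"

definition O_space ::
  "('e::fd_chilbert \<Rightarrow> 'e \<Rightarrow> 'f::fd_hilbert complexification) \<Rightarrow> ('f \<Rightarrow>\<^sub>L real) set \<Rightarrow>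
     ('e \<times> 'f \<Rightarrow> complex) set" where
  "O_space \<Phi> K = {g. smooth g \<and> (\<forall>v p. Zbar \<Phi> v g p = 0) \<and>
     (\<exists>k::nat. \<forall>D. left_invariant_diff_op \<Phi> D \<longrightarrow>
        bounded (range (\<lambda>p. D g p /\<^sub>R (1 + norm p) ^ k))) \<and>
     distribution_support (partial_fourier (fun_distribution g)) \<subseteq> UNIV \<times> K}"

end

theory Submission
  imports Defs "HOL-Probability.Sinc_Integral" "HOL-Complex_Analysis.Cauchy_Integral_Formula"
    "HOL-Real_Asymp.Real_Asymp"
begin

text \<open>The point is that the partial Fourier transform of a CR function \<open>g\<close> vanishes near \<open>(\<zeta>\<^sub>0, \<lambda>)\<close> if
  \<open>\<lambda> \<notin> \<P>\<close>.  Choose \<open>v\<close> with \<open>\<langle>\<lambda>, \<Phi>(v)\<rangle> < 0\<close> and a test function \<open>\<psi>\<close> supported in the open half space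
  where this inequality holds, and let \<open>\<Psi>\<close> be the entire extension of its Fourier transform.  Then
  \<open>(\<zeta>, x) \<mapsto> \<Psi>(x + i (\<Phi>(\<zeta>) - \<Phi>(\<zeta>\<^sub>0)))\<close> is CR, hence so is its product with \<open>g\<close>.  Integrating the
  product over \<open>x\<close> at \<open>\<zeta> = \<zeta>\<^sub>0 + z v\<close> gives an entire function of \<open>z\<close>, because by translation
  invariance the left-invariant derivatives of the integrand may replace the Euclidean ones.  As
  \<open>\<Phi>(\<zeta>\<^sub>0 + z v) - \<Phi>(\<zeta>\<^sub>0)\<close> is \<open>|z|\<^sup>2 \<Phi>(v)\<close> up to a term of order \<open>|z|\<close>, the factor \<open>\<Psi>\<close> decays like a
  Gaussian in \<open>z\<close> while \<open>g\<close> grows polynomially, so the entire function vanishes by Liouville's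
  theorem.  Its value at \<open>z = 0\<close> is the pairing of the Fourier transform of \<open>g(\<zeta>\<^sub>0, \<cdot>)\<close> with \<open>\<psi>\<close>.\<close>

subsection \<open>Differentiation under the integral sign\<close>

text \<open>The obstacle to holomorphy in \<open>z\<close>: for a CR function the derivative is
  complex linear only along the lifts \<open>(v, 2 Im \<Phi>(\<zeta>, v))\<close>, not along
  \<open>(v, 0)\<close>. The curve \<open>(\<zeta>, x)(h v, 0)\<close> has exactly these lifts as
  its directions, and it differs from \<open>(\<zeta> + h v, x)\<close> only by a vertical shift,
  which the integral over \<open>x\<close> does not see. Two estimates make the integrals converge
  locally uniformly. The growth condition speaks of left-invariant operators, so it has to be turned
  into bounds for Euclidean derivatives of \<open>g\<close>. And the transform of
  \<open>\<psi>\<close> at \<open>x + i y\<close> has to be bounded by any negative power of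
  \<open>1 + |x|\<close> times a power of \<open>1 + |y|\<close> times \<open>exp M\<close>, where
  \<open>M\<close> bounds \<open>l . y\<close> for \<open>l\<close> in the support of
  \<open>\<psi>\<close>. The powers in \<open>x\<close> absorb the growth of \<open>g\<close> in
  \<open>x\<close>. The exponential absorbs all growth in \<open>z\<close>: the support is compact
  in an open half space, so there is a uniform gap and \<open>M\<close> behaves like a negative
  multiple of \<open>|z|^2\<close>. Subtracting \<open>\<Phi>(\<zeta>\<^sub>0)\<close> makes the
  imaginary argument vanish at \<open>z = 0\<close>, so that the Fourier transform itself appears
  there.\<close>

lemma dominated_increment_bound:
  fixes f :: "'a::real_normed_vector \<Rightarrow> 'c::real_normed_vector"
  assumes deriv: "\<And>y. y \<in> ball a r \<Longrightarrow> (f has_derivative D y) (at y)"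
    and bound: "\<And>y h. y \<in> ball a r \<Longrightarrow> norm (D y h) \<le> B * norm h"
    and y: "y \<in> ball a r"
  shows "norm (f y - f a) \<le> B * norm (y - a)"
proof (cases "y = a")
  case False
  have "0 \<le> norm (D y (y - a))"
    by simp
  also have "\<dots> \<le> B * norm (y - a)"
    using y by (rule bound)
  finally have B: "0 \<le> B"
    using False by (simp add: zero_le_mult_iff)
  show ?thesis
  proof (rule differentiable_bound[of "ball a r" f D])
    show "(f has_derivative D x) (at x within ball a r)" if "x \<in> ball a r" for x
      using deriv[OF that] by (rule has_derivative_at_withinI)
    show "onorm (D x) \<le> B" if "x \<in> ball a r" for x
      by (rule onorm_bound[OF B]) (rule bound[OF that])
    have "0 < r"
      using y by (metis dist_commute ball_eq_empty empty_iff not_le)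
    then show "a \<in> ball a r"
      by simp
  qed (use y in auto)
qed simp

text \<open>By the mean value inequality the remainder quotients are dominated by
  \<open>2 * B\<close>: one \<open>B\<close> for the increment, one for the linear term. Dominated
  convergence along arbitrary null sequences then gives the full Frechet derivative. Measurability
  of \<open>D a x h\<close> in \<open>x\<close> comes from writing it as a limit of difference
  quotients.\<close>

lemma has_derivative_integral_dominated:
  fixes k :: "'a::real_normed_vector \<Rightarrow> 'b \<Rightarrow> 'c::{banach, second_countable_topology}"
  assumes r: "0 < r"
    and int: "\<And>y. y \<in> ball a r \<Longrightarrow> integrable M (k y)"
    and deriv: "\<And>x y. y \<in> ball a r \<Longrightarrow> ((\<lambda>y. k y x) has_derivative D y x) (at y)"
    and bound: "\<And>x y h. y \<in> ball a r \<Longrightarrow> norm (D y x h) \<le> B x * norm h"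
    and B: "integrable M B"
  shows "integrable M (\<lambda>x. D a x h)"
    and "((\<lambda>y. \<integral>x. k y x \<partial>M) has_derivative (\<lambda>h. \<integral>x. D a x h \<partial>M)) (at a)"
proof -
  have a: "a \<in> ball a r"
    using r by simp
  note Da = deriv[OF a]
  have lim: "(\<lambda>n. norm (k (a + H n) x - k a x - D a x (H n)) / norm (H n)) \<longlonglongrightarrow> 0"
    if "H \<longlonglongrightarrow> 0" "\<And>n. H n \<noteq> 0" for H :: "nat \<Rightarrow> 'a" and x
  proof -
    have "((\<lambda>h. norm (k (a + h) x - k a x - D a x h) / norm h) \<longlongrightarrow> 0) (at 0)"
      using Da[of x] by (simp add: has_derivative_at)
    then show ?thesis
      using that by (auto simp: tendsto_at_iff_sequentially o_def)
  qed
  have D_int: "integrable M (\<lambda>x. D a x h)" for h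
  proof (cases "h = 0")
    case True
    then have "D a x h = 0" for x
      using Da[of x] by (metis has_derivative_bounded_linear linear_simps(3))
    then show ?thesis
      by simp
  next
    case False
    \<comment> \<open>A positive null sequence, scaled so that every
      \<open>a + t n *\<^sub>R h\<close> stays in the ball, where \<open>k\<close> is
      integrable.\<close>
    define t where "t n = min 1 (r / (2 * norm h)) / real (Suc n)" for n
    have t_pos: "t n > 0" for n
      using r False by (simp add: t_def)
    have "(\<lambda>n. min 1 (r / (2 * norm h)) / real (Suc n)) \<longlonglongrightarrow> 0"
      by (rule LIMSEQ_Suc[OF lim_const_over_n])
    then have t_lim: "t \<longlonglongrightarrow> 0"
      by (simp add: t_def[abs_def])
    have t_ball: "a + t n *\<^sub>R h \<in> ball a r" for n
    proof -
      have "min 1 (r / (2 * norm h)) / real (Suc n) \<le> min 1 (r / (2 * norm h)) / 1"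
        using r by (intro divide_left_mono) auto
      then have "t n \<le> r / (2 * norm h)"
        by (simp add: t_def)
      then have "t n * norm h \<le> r / 2"
        using False by (simp add: field_simps)
      then show ?thesis
        using r t_pos[of n] by (simp add: dist_norm)
    qed
    have "(\<lambda>n. (1 / t n) *\<^sub>R (k (a + t n *\<^sub>R h) x - k a x)) \<longlonglongrightarrow> D a x h" for x
    proof -
      have "(\<lambda>n. t n *\<^sub>R h) \<longlonglongrightarrow> 0"
        using tendsto_scaleR[OF t_lim tendsto_const[of h]] by simp
      moreover have "t n *\<^sub>R h \<noteq> 0" for n
        using t_pos[of n] False by simp
      ultimately have "(\<lambda>n. norm (k (a + t n *\<^sub>R h) x - k a x - D a x (t n *\<^sub>R h))
          / norm (t n *\<^sub>R h)) \<longlonglongrightarrow> 0"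
        by (rule lim)
      then have "(\<lambda>n. norm (k (a + t n *\<^sub>R h) x - k a x - D a x (t n *\<^sub>R h))
          / norm (t n *\<^sub>R h) * norm h) \<longlonglongrightarrow> 0 * norm h"
        by (rule tendsto_mult_right)
      moreover have "norm (k (a + t n *\<^sub>R h) x - k a x - D a x (t n *\<^sub>R h))
          / norm (t n *\<^sub>R h) * norm h
          = norm ((1 / t n) *\<^sub>R (k (a + t n *\<^sub>R h) x - k a x) - D a x h)" for n
      proof -
        have "D a x (t n *\<^sub>R h) = t n *\<^sub>R D a x h"
          using has_derivative_bounded_linear[OF Da[of x]] by (simp add: linear_simps)
        then have *: "(1 / t n) *\<^sub>R (k (a + t n *\<^sub>R h) x - k a x) - D a x h
            = (1 / t n) *\<^sub>R (k (a + t n *\<^sub>R h) x - k a x - D a x (t n *\<^sub>R h))"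
          using t_pos[of n] by (simp add: scaleR_diff_right)
        show ?thesis
          unfolding * norm_scaleR using t_pos[of n] False by simp
      qed
      ultimately have "(\<lambda>n. norm ((1 / t n) *\<^sub>R (k (a + t n *\<^sub>R h) x - k a x) - D a x h)) \<longlonglongrightarrow> 0"
        by simp
      then have "(\<lambda>n. (1 / t n) *\<^sub>R (k (a + t n *\<^sub>R h) x - k a x) - D a x h) \<longlonglongrightarrow> 0"
        by (rule tendsto_norm_zero_cancel)
      then show ?thesis
        by (simp add: LIM_zero_iff)
    qed
    moreover have "(\<lambda>x. (1 / t n) *\<^sub>R (k (a + t n *\<^sub>R h) x - k a x)) \<in> borel_measurable M" for n
      using int[OF a] int[OF t_ball[of n]] by (intro borel_measurable_scaleR borel_measurable_diff) auto
    ultimately have "(\<lambda>x. D a x h) \<in> borel_measurable M"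
      by (rule borel_measurable_LIMSEQ_metric[rotated])
    then show ?thesis
      by (rule Bochner_Integration.integrable_bound[rotated 1, where f = "\<lambda>x. B x * norm h"])
        (use B bound[OF a] in \<open>auto intro: order_trans[OF _ abs_ge_self]\<close>)
  qed
  then show "integrable M (\<lambda>x. D a x h)" .
  have bl: "bounded_linear (\<lambda>h. \<integral>x. D a x h \<partial>M)"
  proof (rule bounded_linear_intro[where K = "\<integral>x. B x \<partial>M"])
    have "D a x (h + h') = D a x h + D a x h'" "D a x (c *\<^sub>R h) = c *\<^sub>R D a x h" for x h h' c
      using has_derivative_bounded_linear[OF Da[of x]] by (simp_all add: linear_simps)
    then show "(\<integral>x. D a x (h + h') \<partial>M) = (\<integral>x. D a x h \<partial>M) + (\<integral>x. D a x h' \<partial>M)"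
      and "(\<integral>x. D a x (c *\<^sub>R h) \<partial>M) = c *\<^sub>R (\<integral>x. D a x h \<partial>M)" for h h' c
      using D_int by simp_all
    show "norm (\<integral>x. D a x h \<partial>M) \<le> norm h * (\<integral>x. B x \<partial>M)" for h
    proof -
      have "norm (\<integral>x. D a x h \<partial>M) \<le> (\<integral>x. B x * norm h \<partial>M)"
        using D_int[of h] B bound[OF a]
        by (intro order_trans[OF integral_norm_bound] integral_mono) auto
      then show ?thesis
        by (simp add: mult.commute)
    qed
  qed
  show "((\<lambda>y. \<integral>x. k y x \<partial>M) has_derivative (\<lambda>h. \<integral>x. D a x h \<partial>M)) (at a)"
    unfolding has_derivative_at
  proof (intro conjI bl, unfold tendsto_at_iff_sequentially, intro allI impI)
    fix H :: "nat \<Rightarrow> 'a"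
    assume H0: "\<forall>n. H n \<in> UNIV - {0}" and H: "H \<longlonglongrightarrow> 0"
    have "eventually (\<lambda>n. dist (H n) 0 < r) sequentially"
      using H r by (rule tendstoD)
    then have ev: "eventually (\<lambda>n. a + H n \<in> ball a r) sequentially"
      by eventually_elim (simp add: dist_norm)
    define Q where "Q n x = (1 / norm (H n)) *\<^sub>R (k (a + H n) x - k a x - D a x (H n))" for n x
    have Q_int: "integrable M (Q n)" if "a + H n \<in> ball a r" for n
      unfolding Q_def using int[OF that] int[OF a] D_int by auto
    \<comment> \<open>The increments lie in the ball only eventually; the shift by \<open>N\<close>
      makes every quotient integrable and dominated, as dominated convergence demands for all
      indices.\<close>
    obtain N where N: "\<And>n. n \<ge> N \<Longrightarrow> a + H n \<in> ball a r"
      using ev by (auto simp: eventually_sequentially)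
    have "(\<lambda>n. \<integral>x. Q (n + N) x \<partial>M) \<longlonglongrightarrow> (\<integral>x. 0 \<partial>M)"
    proof (rule integral_dominated_convergence[where w = "\<lambda>x. 2 * B x"])
      show "(\<lambda>x. 0) \<in> borel_measurable M" "integrable M (\<lambda>x. 2 * B x)"
        using B by auto
      show "Q (n + N) \<in> borel_measurable M" for n
        using Q_int[OF N[of "n + N"]] by auto
      show "AE x in M. (\<lambda>n. Q (n + N) x) \<longlonglongrightarrow> 0"
      proof (rule AE_I2)
        fix x
        have "(\<lambda>n. norm (k (a + H n) x - k a x - D a x (H n)) / norm (H n)) \<longlonglongrightarrow> 0"
          using H H0 by (intro lim) auto
        then have "(\<lambda>n. norm (Q n x)) \<longlonglongrightarrow> 0"
          by (simp add: Q_def divide_inverse mult.commute)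
        then have "(\<lambda>n. Q n x) \<longlonglongrightarrow> 0"
          by (rule tendsto_norm_zero_cancel)
        then show "(\<lambda>n. Q (n + N) x) \<longlonglongrightarrow> 0"
          by (rule LIMSEQ_ignore_initial_segment)
      qed
      show "AE x in M. norm (Q (n + N) x) \<le> 2 * B x" for n
      proof (rule AE_I2)
        fix x
        let ?h = "H (n + N)"
        have "norm (k (a + ?h) x - k a x) \<le> B x * norm (a + ?h - a)"
          by (rule dominated_increment_bound[where D = "\<lambda>y. D y x"])
            (use deriv bound N[of "n + N"] in auto)
        then have "norm (k (a + ?h) x - k a x - D a x ?h) \<le> 2 * B x * norm ?h"
          using bound[OF a, of x ?h] norm_triangle_ineq4[of "k (a + ?h) x - k a x" "D a x ?h"] by simp
        moreover have "norm ?h > 0"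
          using H0 by simp
        ultimately show "norm (Q (n + N) x) \<le> 2 * B x"
          unfolding Q_def norm_scaleR by (simp add: pos_divide_le_eq)
      qed
    qed
    then have "(\<lambda>n. norm (\<integral>x. Q (n + N) x \<partial>M)) \<longlonglongrightarrow> 0"
      by (simp add: tendsto_norm_zero)
    moreover have "norm (\<integral>x. Q (n + N) x \<partial>M) = norm ((\<integral>x. k (a + H (n + N)) x \<partial>M) - (\<integral>x. k a x \<partial>M)
        - (\<integral>x. D a x (H (n + N)) \<partial>M)) / norm (H (n + N))" for n
      unfolding Q_def using int[OF N[of "n + N"]] int[OF a] D_int by simp
    ultimately have "(\<lambda>n. norm ((\<integral>x. k (a + H (n + N)) x \<partial>M) - (\<integral>x. k a x \<partial>M)
        - (\<integral>x. D a x (H (n + N)) \<partial>M)) / norm (H (n + N))) \<longlonglongrightarrow> 0"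
      by simp
    then have "(\<lambda>n. norm ((\<integral>x. k (a + H n) x \<partial>M) - (\<integral>x. k a x \<partial>M)
        - (\<integral>x. D a x (H n) \<partial>M)) / norm (H n)) \<longlonglongrightarrow> 0"
      by (rule LIMSEQ_offset)
    then show "((\<lambda>h. norm ((\<integral>x. k (a + h) x \<partial>M) - (\<integral>x. k a x \<partial>M)
        - (\<integral>x. D a x h \<partial>M)) / norm h) \<circ> H) \<longlonglongrightarrow> 0"
      by (simp add: o_def)
  qed
qed

subsection \<open>Lebesgue measure of a finite-dimensional Hilbert space\<close>

lemma norm_onb: "b \<in> onb \<Longrightarrow> norm b = 1"
  by (simp add: norm_eq_sqrt_inner inner_onb)

lemma inner_onb_sum:
  assumes "b \<in> onb"
  shows "(\<Sum>c\<in>onb. f c *\<^sub>R c) \<bullet> b = f b"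
proof -
  have "(\<Sum>c\<in>onb. f c *\<^sub>R c) \<bullet> b = (\<Sum>c\<in>onb. if c = b then f c else 0)"
    unfolding inner_sum_left using assms by (intro sum.cong) (auto simp: inner_onb)
  also have "\<dots> = f b"
    using assms by (simp add: sum.delta[OF finite_onb])
  finally show ?thesis .
qed

lemma onb_expansion: "(\<Sum>b\<in>onb. (x \<bullet> b) *\<^sub>R b) = x"
proof -
  have "\<forall>b\<in>onb. ((\<Sum>b\<in>onb. (x \<bullet> b) *\<^sub>R b) - x) \<bullet> b = 0"
    by (simp add: inner_diff_left inner_onb_sum)
  then show ?thesis
    by (simp only: onb_all_zero_iff) simp
qed

text \<open>Weights in \<open>x\<close> are powers of \<open>1 + l1norm x\<close> because the
  summands \<open>\<bar>x \<bullet> b\<bar>\<close> are the factors that differentiating a test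
  function along \<open>b\<close> produces in its Fourier transform.\<close>

definition l1norm :: "'a::fd_hilbert \<Rightarrow> real" where
  "l1norm x = (\<Sum>b\<in>onb. \<bar>x \<bullet> b\<bar>)"

lemma l1norm_nonneg [simp]: "0 \<le> l1norm x"
  by (simp add: l1norm_def sum_nonneg)

lemma norm_le_l1norm: "norm x \<le> l1norm x"
proof -
  have "norm (\<Sum>b\<in>onb. (x \<bullet> b) *\<^sub>R b) \<le> (\<Sum>b\<in>onb. norm ((x \<bullet> b) *\<^sub>R b))"
    by (rule norm_sum)
  also have "\<dots> = l1norm x"
    by (simp add: l1norm_def norm_onb)
  finally show ?thesis
    by (simp add: onb_expansion)
qed

lemma l1norm_le_norm: "l1norm (x::'a::fd_hilbert) \<le> real (card (onb :: 'a set)) * norm x"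
  unfolding l1norm_def
  by (rule order_trans[OF sum_bounded_above[where K = "norm x"]])
    (auto intro: order_trans[OF Cauchy_Schwarz_ineq2] simp: norm_onb)

lemma l1norm_triangle: "l1norm (x + y) \<le> l1norm x + l1norm y"
  unfolding l1norm_def sum.distrib[symmetric] inner_add_left
  by (intro sum_mono abs_triangle_ineq)

text \<open>Growth conditions provide one constant for each fixed direction; expanding over the
  basis turns finitely many of them into a bound uniform in the direction.\<close>

lemma norm_linear_le_onb:
  fixes f :: "'a::fd_hilbert \<Rightarrow> 'b::real_normed_vector"
  assumes "linear f" and bound: "\<And>b. b \<in> onb \<Longrightarrow> norm (f b) \<le> c b"
  shows "norm (f x) \<le> (\<Sum>b\<in>onb. c b) * norm x"
proof -
  interpret linear f by fact
  have "f x = f (\<Sum>b\<in>onb. (x \<bullet> b) *\<^sub>R b)"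
    by (simp add: onb_expansion)
  also have "\<dots> = (\<Sum>b\<in>onb. (x \<bullet> b) *\<^sub>R f b)"
    by (simp add: sum scale)
  also have "norm \<dots> \<le> (\<Sum>b\<in>onb. norm ((x \<bullet> b) *\<^sub>R f b))"
    by (rule norm_sum)
  also have "\<dots> \<le> (\<Sum>b\<in>onb. norm x * c b)"
  proof (rule sum_mono)
    fix b :: 'a
    assume b: "b \<in> onb"
    then have "\<bar>x \<bullet> b\<bar> \<le> norm x"
      using Cauchy_Schwarz_ineq2[of x b] by (simp add: norm_onb)
    then show "norm ((x \<bullet> b) *\<^sub>R f b) \<le> norm x * c b"
      using bound[OF b] by (simp add: mult_mono)
  qed
  finally show ?thesis
    by (simp add: sum_distrib_left mult.commute)
qed

lemma bounded_linear_fd_hilbert: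
  fixes f :: "'a::fd_hilbert \<Rightarrow> 'b::real_normed_vector"
  assumes f: "linear f"
  shows "bounded_linear f"
proof (rule bounded_linear_intro[where K = "\<Sum>b\<in>onb. norm (f b)"])
  show "norm (f x) \<le> norm x * (\<Sum>b\<in>onb. norm (f b))" for x
    using norm_linear_le_onb[OF f order_refl, of x] by (simp add: mult.commute)
qed (simp_all add: linear_add[OF f] linear_scale[OF f])

lemma bounded_bilinear_fd_hilbert:
  fixes f :: "'a::fd_hilbert \<Rightarrow> 'b::fd_hilbert \<Rightarrow> 'c::real_normed_vector"
  assumes left: "\<And>y. linear (\<lambda>x. f x y)" and right: "\<And>x. linear (f x)"
  shows "bounded_bilinear f"
proof (rule bounded_bilinear.intro)
  show "\<exists>K. \<forall>x y. norm (f x y) \<le> norm x * norm y * K"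
  proof (intro exI allI)
    fix x y
    have "norm (f x y) \<le> (\<Sum>b\<in>onb. onorm (f b) * norm y) * norm x"
      by (rule norm_linear_le_onb[OF left]) (rule onorm[OF bounded_linear_fd_hilbert[OF right]])
    then show "norm (f x y) \<le> norm x * norm y * (\<Sum>b\<in>onb. onorm (f b))"
      by (simp add: sum_distrib_right[symmetric] mult.assoc) (simp add: mult_ac)
  qed
qed (simp_all add: linear_add[OF left] linear_scale[OF left] linear_add[OF right] linear_scale[OF right])

interpretation lborel_product: product_sigma_finite "\<lambda>_. lborel :: real measure"
  by standard

text \<open>The source carries the product sigma-algebra of the coordinates, so the preimage of an
  open set is exhausted by countably many boxes with rational centre and radius, which are
  measurable rectangles.\<close>

lemma borel_measurable_onb_sum [measurable]:
  "(\<lambda>f. \<Sum>b\<in>onb. f b *\<^sub>R b) \<in> borel_measurable (\<Pi>\<^sub>M b\<in>(onb::'a::fd_hilbert set). lborel)"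
proof (rule borel_measurableI)
  let ?M = "\<Pi>\<^sub>M b\<in>(onb::'a set). (lborel :: real measure)" and ?T = "\<lambda>f. \<Sum>b\<in>(onb::'a set). f b *\<^sub>R b"
  fix S :: "'a set"
  assume S: "open S"
  let ?box = "\<lambda>(q, d). Pi\<^sub>E (onb::'a set) (\<lambda>b. ball (q b) d)"
  define I where "I = {qd \<in> (Pi\<^sub>E (onb::'a set) (\<lambda>_. \<rat>)) \<times> \<rat>. ?box qd \<subseteq> ?T -` S}"
  have "countable I"
    unfolding I_def
    by (rule countable_subset[OF Collect_restrict])
      (intro countable_SIGMA countable_PiE finite_onb countable_rat)
  moreover have "?box qd \<in> sets ?M" for qd :: "('a \<Rightarrow> real) \<times> real"
    by (cases qd) (auto intro!: sets_PiM_I_finite finite_onb)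
  moreover have "?T -` S \<inter> space ?M = (\<Union>qd\<in>I. ?box qd)"
  proof
    show "?T -` S \<inter> space ?M \<subseteq> (\<Union>qd\<in>I. ?box qd)"
    proof
      fix f
      assume f: "f \<in> ?T -` S \<inter> space ?M"
      then obtain e where e: "e > 0" "ball (?T f) e \<subseteq> S"
        using S by (auto simp: open_contains_ball)
      \<comment> \<open>Two points of a box of radius \<open>d\<close> differ by less than
        \<open>2 * d\<close> in each coordinate, hence their images by less than \<open>e\<close>;
        the \<open>+ 1\<close> covers an empty basis.\<close>
      obtain d where d: "d \<in> \<rat>" "0 < d" "d < e / (2 * (real (card (onb::'a set)) + 1))"
        using Rats_dense_in_real[of 0 "e / (2 * (real (card (onb::'a set)) + 1))"] e by auto
      have "\<exists>q\<in>\<rat>. \<bar>q - f b\<bar> < d" for b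
        using Rats_dense_in_real[of "f b - d" "f b + d"] d by force
      then obtain q where q: "\<And>b. q b \<in> \<rat>" "\<And>b. \<bar>q b - f b\<bar> < d"
        by metis
      define q' where "q' = restrict q onb"
      have "?T g \<in> S" if g: "g \<in> ?box (q', d)" for g
      proof -
        have "norm (?T g - ?T f) = norm (\<Sum>b\<in>onb. (g b - f b) *\<^sub>R (b::'a))"
          by (simp add: sum_subtractf scaleR_diff_left)
        also have "\<dots> \<le> (\<Sum>b\<in>(onb::'a set). 2 * d)"
        proof (rule order_trans[OF norm_sum], rule sum_mono)
          fix b :: 'a
          assume b: "b \<in> onb"
          then have "\<bar>q b - g b\<bar> < d"
            using g by (auto simp: q'_def dist_real_def PiE_def Pi_def)
          then show "norm ((g b - f b) *\<^sub>R b) \<le> 2 * d"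
            using q(2)[of b] b by (simp add: norm_onb)
        qed
        also have "\<dots> < e"
          using d(2,3) e(1) by (simp add: field_simps)
        finally have "?T g \<in> ball (?T f) e"
          by (simp add: dist_norm norm_minus_commute)
        then show ?thesis
          using e by blast
      qed
      then have "(q', d) \<in> I"
        using q d by (auto simp: I_def q'_def)
      moreover have "f \<in> ?box (q', d)"
        using f q by (auto simp: q'_def space_PiM dist_real_def)
      ultimately show "f \<in> (\<Union>qd\<in>I. ?box qd)"
        by blast
    qed
    show "(\<Union>qd\<in>I. ?box qd) \<subseteq> ?T -` S \<inter> space ?M"
    proof
      fix f
      assume "f \<in> (\<Union>qd\<in>I. ?box qd)"
      then obtain qd where qd: "qd \<in> I" "f \<in> ?box qd"
        by blast
      then have "f \<in> ?T -` S"
        unfolding I_def by blast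
      moreover have "f \<in> space ?M"
        using qd(2) by (auto simp: space_PiM split: prod.splits)
      ultimately show "f \<in> ?T -` S \<inter> space ?M"
        by blast
    qed
  qed
  ultimately show "?T -` S \<inter> space ?M \<in> sets ?M"
    by (simp only:) (intro sets.countable_UN'' ballI)
qed

lemma sets_hborel [simp, measurable_cong]: "sets hborel = sets borel"
  by (simp add: hborel_def)

lemma space_hborel [simp]: "space hborel = UNIV"
  by (simp add: hborel_def)

lemma emeasure_hborel_cube:
  "emeasure hborel {x::'a::fd_hilbert. \<forall>b\<in>onb. \<bar>x \<bullet> b\<bar> \<le> r} < \<infinity>"
proof -
  let ?S = "{x::'a. \<forall>b\<in>onb. \<bar>x \<bullet> b\<bar> \<le> r}"
  have "?S = (\<Inter>b\<in>onb. {x. \<bar>x \<bullet> b\<bar> \<le> r})"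
    by auto
  also have "closed \<dots>"
    by (intro closed_INT ballI closed_Collect_le continuous_intros)
  finally have "?S \<in> sets borel"
    by (rule borel_closed)
  then have "emeasure hborel ?S = emeasure (\<Pi>\<^sub>M b\<in>(onb::'a set). lborel)
      ((\<lambda>f. \<Sum>b\<in>onb. f b *\<^sub>R b) -` ?S \<inter> space (\<Pi>\<^sub>M b\<in>(onb::'a set). lborel))"
    unfolding hborel_def by (intro emeasure_distr) auto
  also have "(\<lambda>f. \<Sum>b\<in>onb. f b *\<^sub>R b) -` ?S \<inter> space (\<Pi>\<^sub>M b\<in>(onb::'a set). lborel)
      = Pi\<^sub>E onb (\<lambda>_. {-r..r})"
    by (auto simp: space_PiM inner_onb_sum PiE_def Pi_def abs_le_iff minus_le_iff)
  also have "emeasure (\<Pi>\<^sub>M b\<in>(onb::'a set). lborel) \<dots> = (\<Prod>b\<in>(onb::'a set). emeasure lborel {-r..r})"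
    by (intro lborel_product.emeasure_PiM finite_onb) auto
  also have "\<dots> < \<infinity>"
    by (auto simp: less_top[symmetric] emeasure_lborel_Icc_eq power_eq_top_ennreal)
  finally show ?thesis .
qed

lemma emeasure_hborel_bounded:
  fixes A :: "'a::fd_hilbert set"
  assumes "bounded A"
  shows "emeasure hborel A < \<infinity>"
proof -
  obtain r where r: "\<And>x. x \<in> A \<Longrightarrow> norm x \<le> r"
    using assms by (auto simp: bounded_iff)
  have "A \<subseteq> {x. \<forall>b\<in>onb. \<bar>x \<bullet> b\<bar> \<le> r}"
    using r by (auto intro!: order_trans[OF Cauchy_Schwarz_ineq2] simp: norm_onb)
  moreover have "{x::'a. \<forall>b\<in>onb. \<bar>x \<bullet> b\<bar> \<le> r} = (\<Inter>b\<in>onb. {x. \<bar>x \<bullet> b\<bar> \<le> r})"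
    by auto
  moreover have "closed (\<Inter>b\<in>onb. {x::'a. \<bar>x \<bullet> b\<bar> \<le> r})"
    by (intro closed_INT ballI closed_Collect_le continuous_intros)
  ultimately have "emeasure hborel A \<le> emeasure hborel {x::'a. \<forall>b\<in>onb. \<bar>x \<bullet> b\<bar> \<le> r}"
    by (intro emeasure_mono) (simp_all only: sets_hborel borel_closed)
  then show ?thesis
    using emeasure_hborel_cube by (rule le_less_trans)
qed

interpretation hborel: sigma_finite_measure "hborel :: 'a::fd_hilbert measure"
proof
  show "\<exists>A. countable A \<and> A \<subseteq> sets (hborel :: 'a measure) \<and> \<Union> A = space hborel
      \<and> (\<forall>a\<in>A. emeasure hborel a \<noteq> (\<infinity>::ennreal))"
  proof (intro exI conjI)
    let ?A = "range (\<lambda>n. cball (0::'a) (real n))"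
    show "countable ?A" by simp
    show "?A \<subseteq> sets hborel" by (auto intro: borel_closed)
    show "\<Union> ?A = space hborel" by (auto simp: real_arch_simple)
    show "\<forall>a\<in>?A. emeasure hborel a \<noteq> \<infinity>"
      using emeasure_hborel_bounded[OF bounded_cball] by (metis (no_types, lifting) imageE less_irrefl)
  qed
qed

text \<open>In coordinates a translation is a product of shifts of the line. The lemma serves twice:
  for integration by parts, and for removing the vertical shift caused by the group law.\<close>

lemma hborel_translate: "distr hborel borel (\<lambda>x. x + c) = (hborel :: 'a::fd_hilbert measure)"
proof -
  let ?P = "\<Pi>\<^sub>M b\<in>(onb::'a set). (lborel :: real measure)"
  let ?T = "\<lambda>f. \<Sum>b\<in>(onb::'a set). f b *\<^sub>R b"
  let ?s = "\<lambda>f. \<lambda>b\<in>onb. f b + c \<bullet> b"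
  have s [measurable]: "?s \<in> measurable ?P ?P"
    by (intro measurable_restrict) auto
  have "distr ?P ?P ?s = ?P"
  proof (rule lborel_product.PiM_eqI)
    fix A :: "'a \<Rightarrow> real set"
    assume A: "\<And>b. b \<in> onb \<Longrightarrow> A b \<in> sets lborel"
    have "emeasure (distr ?P ?P ?s) (Pi\<^sub>E onb A) = emeasure ?P (?s -` Pi\<^sub>E onb A \<inter> space ?P)"
      using A by (intro emeasure_distr s sets_PiM_I_finite finite_onb) auto
    also have "?s -` Pi\<^sub>E onb A \<inter> space ?P = Pi\<^sub>E onb (\<lambda>b. (\<lambda>t. t + c \<bullet> b) -` A b)"
      by (auto simp: space_PiM PiE_def Pi_def)
    also have "emeasure ?P \<dots> = (\<Prod>b\<in>onb. emeasure lborel ((\<lambda>t. t + c \<bullet> b) -` A b))"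
    proof (rule lborel_product.emeasure_PiM[OF finite_onb])
      fix b :: 'a
      assume "b \<in> onb"
      then show "(\<lambda>t. t + c \<bullet> b) -` A b \<in> sets lborel"
        using measurable_sets[of "\<lambda>t::real. t + c \<bullet> b" borel borel "A b"] A by simp
    qed
    also have "\<dots> = (\<Prod>b\<in>onb. emeasure lborel (A b))"
    proof (rule prod.cong[OF refl])
      fix b :: 'a
      assume "b \<in> onb"
      then have "A b \<in> sets borel"
        using A by simp
      then have "emeasure (distr lborel borel ((+) (c \<bullet> b))) (A b)
          = emeasure lborel ((\<lambda>t. t + c \<bullet> b) -` A b)"
        by (subst emeasure_distr) (simp_all add: vimage_def add.commute)
      then show "emeasure lborel ((\<lambda>t. t + c \<bullet> b) -` A b) = emeasure lborel (A b)"
        by (simp only: lborel_distr_plus)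
    qed
    finally show "emeasure (distr ?P ?P ?s) (Pi\<^sub>E onb A) = (\<Prod>b\<in>onb. emeasure lborel (A b))" .
  qed (auto intro: finite_onb)
  then have "hborel = distr (distr ?P ?P ?s) borel ?T"
    by (simp add: hborel_def)
  also have "\<dots> = distr ?P borel (?T \<circ> ?s)"
    by (rule distr_distr) auto
  also have "?T \<circ> ?s = (\<lambda>x. x + c) \<circ> ?T"
  proof
    show "(?T \<circ> ?s) f = ((\<lambda>x. x + c) \<circ> ?T) f" for f
      by (simp add: scaleR_add_left sum.distrib onb_expansion)
  qed
  also have "distr ?P borel \<dots> = distr (distr ?P borel ?T) borel (\<lambda>x. x + c)"
    by (rule distr_distr[symmetric])
      (auto intro!: borel_measurable_continuous_onI continuous_intros)
  finally show ?thesis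
    by (simp add: hborel_def)
qed

lemma continuous_on_borel_measurable_hborel:
  "continuous_on UNIV f \<Longrightarrow> f \<in> borel_measurable (hborel :: 'a::fd_hilbert measure)"
  by (subst measurable_cong_sets[OF sets_hborel refl]) (rule borel_measurable_continuous_onI)

lemma hborel_translate_continuous:
  fixes f :: "'a::fd_hilbert \<Rightarrow> 'c::{banach, second_countable_topology}"
  assumes "continuous_on UNIV f"
  shows "(\<integral>x. f (x + c) \<partial>hborel) = (\<integral>x. f x \<partial>hborel)"
proof -
  have "(\<integral>x. f x \<partial>distr hborel borel (\<lambda>x. x + c)) = (\<integral>x. f (x + c) \<partial>hborel)"
    by (intro integral_distr continuous_on_borel_measurable_hborel borel_measurable_continuous_onI
        assms continuous_intros)
  then show ?thesis
    by (simp add: hborel_translate)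
qed

text \<open>Each factor \<open>1 + (x \<bullet> b)\<^sup>2\<close> is at most
  \<open>(1 + l1norm x)\<^sup>2\<close>, so the weight is dominated by a product of functions
  \<open>1 / (1 + t^2)\<close> of one coordinate each. This is the origin of the exponent.\<close>

lemma integrable_l1norm_power:
  "integrable hborel (\<lambda>x::'a::fd_hilbert. 1 / (1 + l1norm x) ^ (2 * card (onb :: 'a set)))"
proof (rule Bochner_Integration.integrable_bound)
  let ?P = "\<Pi>\<^sub>M b\<in>(onb::'a set). (lborel :: real measure)"
  let ?T = "\<lambda>f. \<Sum>b\<in>(onb::'a set). f b *\<^sub>R b"
  have "integrable lborel (\<lambda>t::real. inverse (1 + t\<^sup>2))"
    using integrable_inverse_1_plus_square by (simp add: set_integrable_def einterval_def)
  then have "integrable ?P (\<lambda>f. \<Prod>b\<in>onb. inverse (1 + (f b)\<^sup>2))"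
    by (intro lborel_product.product_integrable_prod finite_onb)
  also have "?this \<longleftrightarrow> integrable ?P (\<lambda>f. \<Prod>b\<in>onb. inverse (1 + (?T f \<bullet> b)\<^sup>2))"
    by (intro Bochner_Integration.integrable_cong prod.cong) (simp_all add: inner_onb_sum)
  also have "\<dots> \<longleftrightarrow> integrable hborel (\<lambda>x::'a. \<Prod>b\<in>onb. inverse (1 + (x \<bullet> b)\<^sup>2))"
    unfolding hborel_def
    by (intro integrable_distr_eq[symmetric] borel_measurable_onb_sum borel_measurable_continuous_onI
        continuous_intros) (auto simp: add_nonneg_eq_0_iff)
  finally show "integrable hborel (\<lambda>x::'a. \<Prod>b\<in>onb. inverse (1 + (x \<bullet> b)\<^sup>2))" .
  have "1 + l1norm x \<noteq> 0" for x :: 'a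
    using l1norm_nonneg[of x] by linarith
  then show "(\<lambda>x::'a. 1 / (1 + l1norm x) ^ (2 * card (onb :: 'a set))) \<in> borel_measurable hborel"
    unfolding l1norm_def
    by (intro continuous_on_borel_measurable_hborel continuous_intros) auto
  show "AE x in hborel. norm (1 / (1 + l1norm (x::'a)) ^ (2 * card (onb :: 'a set)))
      \<le> norm (\<Prod>b\<in>onb. inverse (1 + (x \<bullet> b)\<^sup>2))"
  proof (rule AE_I2)
    fix x :: 'a
    have "(\<Prod>b\<in>onb. 1 + (x \<bullet> b)\<^sup>2) \<le> (\<Prod>b\<in>(onb :: 'a set). (1 + l1norm x)\<^sup>2)"
    proof (intro prod_mono conjI)
      fix b :: 'a
      assume b: "b \<in> onb"
      have "\<bar>x \<bullet> b\<bar> \<le> l1norm x"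
        unfolding l1norm_def using b finite_onb by (intro member_le_sum) auto
      then have "(x \<bullet> b)\<^sup>2 \<le> (l1norm x)\<^sup>2"
        using power_mono[of "\<bar>x \<bullet> b\<bar>" "l1norm x" 2] by simp
      then show "1 + (x \<bullet> b)\<^sup>2 \<le> (1 + l1norm x)\<^sup>2"
        using l1norm_nonneg[of x] by (simp add: power2_sum add_increasing2)
    qed auto
    also have "\<dots> = (1 + l1norm x) ^ (2 * card (onb :: 'a set))"
      by (simp add: power_mult)
    finally have le: "(\<Prod>b\<in>onb. 1 + (x \<bullet> b)\<^sup>2) \<le> (1 + l1norm x) ^ (2 * card (onb :: 'a set))" .
    have "0 < (\<Prod>b\<in>onb. 1 + (x \<bullet> b)\<^sup>2)"
      by (intro prod_pos) (auto intro: add_pos_nonneg)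
    then show "norm (1 / (1 + l1norm x) ^ (2 * card (onb :: 'a set)))
      \<le> norm (\<Prod>b\<in>onb. inverse (1 + (x \<bullet> b)\<^sup>2))"
      using le le_imp_inverse_le[OF le] l1norm_nonneg[of x]
      by (simp only: prod_inversef[symmetric] o_def divide_inverse real_norm_def mult_1_left)
        (smt (verit) inverse_nonnegative_iff_nonnegative)
  qed
qed

subsection \<open>Smooth functions\<close>

lemma iter_deriv_append: "iter_deriv (vs @ ws) f = iter_deriv vs (iter_deriv ws f)"
  by (induction vs) auto

lemma smooth_iter_deriv: "smooth f \<Longrightarrow> smooth (iter_deriv ws f)"
  unfolding smooth_def by (metis iter_deriv_append)

lemma smooth_differentiable: "smooth f \<Longrightarrow> f differentiable (at p)"
  unfolding smooth_def by (metis iter_deriv.simps(1))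

lemma smooth_has_derivative:
  "smooth f \<Longrightarrow> (f has_derivative frechet_derivative f (at p)) (at p)"
  using smooth_differentiable frechet_derivative_works by blast

lemma smooth_continuous_on: "smooth f \<Longrightarrow> continuous_on S f"
  by (meson continuous_at_imp_continuous_on differentiable_imp_continuous_within
      smooth_differentiable)

lemma smooth_frechet_derivative: "smooth f \<Longrightarrow> smooth (\<lambda>p. frechet_derivative f (at p) v)"
  using smooth_iter_deriv[of f "[v]"] by simp

lemma smooth_bounded_linear:
  assumes "bounded_linear L"
  shows "smooth (\<lambda>p. L p + c)"
proof -
  have "\<exists>L c. bounded_linear L \<and> iter_deriv vs (\<lambda>p. L0 p + c0) = (\<lambda>p. L p + c)"
    if "bounded_linear L0" for vs and L0 :: "'a \<Rightarrow> complex" and c0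
  proof (induction vs)
    case Nil
    then show ?case
      using that by auto
  next
    case (Cons v vs)
    then obtain L c where L: "bounded_linear L" and eq: "iter_deriv vs (\<lambda>p. L0 p + c0) = (\<lambda>p. L p + c)"
      by blast
    have "((\<lambda>p. L p + c) has_derivative L) (at p)" for p
      using has_derivative_add[OF bounded_linear_imp_has_derivative[OF L] has_derivative_const[of c]]
      by simp
    then have "frechet_derivative (\<lambda>p. L p + c) (at p) = L" for p
      by (metis frechet_derivative_at)
    then have "iter_deriv (v # vs) (\<lambda>p. L0 p + c0) = (\<lambda>p. (\<lambda>_. 0) p + L v)"
      by (simp add: eq)
    then show ?case
      using bounded_linear_zero by blast
  qed
  moreover have "(\<lambda>p. L p + c) differentiable (at p)" if "bounded_linear L"
    for L :: "'a \<Rightarrow> complex" and c p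
    using bounded_linear_imp_differentiable[OF that] by simp
  ultimately show ?thesis
    unfolding smooth_def using assms by metis
qed

lemma smooth_const: "smooth (\<lambda>_. c)"
  using smooth_bounded_linear[OF bounded_linear_zero, of c] by simp

lemma has_derivative_sum_list_mult:
  fixes L :: "(('a::real_normed_vector \<Rightarrow> complex) \<times> ('a \<Rightarrow> complex)) list"
  assumes "\<forall>(f, g)\<in>set L. f differentiable (at p) \<and> g differentiable (at p)"
  shows "((\<lambda>p. \<Sum>(f, g)\<leftarrow>L. f p * g p) has_derivative
    (\<lambda>v. \<Sum>(f, g)\<leftarrow>L. f p * frechet_derivative g (at p) v + frechet_derivative f (at p) v * g p))
    (at p)"
  using assms
proof (induction L)
  case (Cons fg L)
  obtain f g where [simp]: "fg = (f, g)"
    by (cases fg)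
  have "(f has_derivative frechet_derivative f (at p)) (at p)"
    "(g has_derivative frechet_derivative g (at p)) (at p)"
    using Cons.prems by (simp_all add: frechet_derivative_works[symmetric])
  from has_derivative_add[OF has_derivative_mult[OF this] Cons.IH] Cons.prems show ?case
    by simp
qed simp

text \<open>A single product is not stable under differentiation, but finite sums of products are:
  the Leibniz rule replaces each pair by two. Hence the induction runs over all lists
  \<open>L\<close>.\<close>

lemma smooth_sum_list_mult:
  assumes "\<forall>(f, g)\<in>set L. smooth f \<and> smooth g"
  shows "smooth (\<lambda>p. \<Sum>(f, g)\<leftarrow>L. f p * g p)"
  unfolding smooth_def
proof (intro allI)
  fix vs p
  show "iter_deriv vs (\<lambda>p. \<Sum>(f, g)\<leftarrow>L. f p * g p) differentiable (at p)"
    using assms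
  \<comment> \<open>\<open>iter_deriv\<close> applies the last direction of the list first, so
    peeling off the end puts the Leibniz rule on the sum itself.\<close>
  proof (induction vs arbitrary: L rule: rev_induct)
    case Nil
    then have "\<forall>(f, g)\<in>set L. f differentiable (at p) \<and> g differentiable (at p)"
      using smooth_differentiable by blast
    from has_derivative_sum_list_mult[OF this] show ?case
      by (auto simp: differentiable_def)
  next
    case (snoc v vs)
    define L' where "L' = concat (map (\<lambda>(f, g).
      [(f, \<lambda>p. frechet_derivative g (at p) v), (\<lambda>p. frechet_derivative f (at p) v, g)]) L)"
    have "frechet_derivative (\<lambda>p. \<Sum>(f, g)\<leftarrow>L. f p * g p) (at p) v = (\<Sum>(f, g)\<leftarrow>L'. f p * g p)" for p
    proof -
      have "\<forall>(f, g)\<in>set L. f differentiable (at p) \<and> g differentiable (at p)"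
        using snoc.prems smooth_differentiable by blast
      from frechet_derivative_at[OF has_derivative_sum_list_mult[OF this], symmetric]
      have "frechet_derivative (\<lambda>p. \<Sum>(f, g)\<leftarrow>L. f p * g p) (at p) v
          = (\<Sum>(f, g)\<leftarrow>L. f p * frechet_derivative g (at p) v + frechet_derivative f (at p) v * g p)"
        by simp
      also have "\<dots> = (\<Sum>(f, g)\<leftarrow>L'. f p * g p)"
        unfolding L'_def by (induction L) (auto simp: add.assoc)
      finally show ?thesis .
    qed
    moreover have "\<forall>(f, g)\<in>set L'. smooth f \<and> smooth g"
      using snoc.prems smooth_frechet_derivative by (fastforce simp: L'_def)
    then have "iter_deriv vs (\<lambda>p. \<Sum>(f, g)\<leftarrow>L'. f p * g p) differentiable (at p)"
      by (rule snoc.IH)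
    ultimately show ?case
      by (simp add: iter_deriv_append)
  qed
qed

lemma smooth_mult: "smooth f \<Longrightarrow> smooth g \<Longrightarrow> smooth (\<lambda>p. f p * g p)"
  using smooth_sum_list_mult[of "[(f, g)]"] by simp

lemma smooth_compose_affine:
  fixes f :: "'b::real_normed_vector \<Rightarrow> complex"
  assumes f: "smooth f" and L: "bounded_linear L"
  shows "smooth (\<lambda>p. f (a + L p))"
proof -
  have diff: "((\<lambda>p. h (a + L p)) has_derivative (\<lambda>v. frechet_derivative h (at (a + L p)) (L v))) (at p)"
    if "smooth h" for h :: "'b \<Rightarrow> complex" and p
  proof -
    have "((\<lambda>p. a + L p) has_derivative (\<lambda>v. 0 + L v)) (at p)"
      by (intro has_derivative_add has_derivative_const bounded_linear_imp_has_derivative L)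
    then have "((\<lambda>p. a + L p) has_derivative L) (at p)"
      by simp
    from has_derivative_compose[OF this smooth_has_derivative[OF that]] show ?thesis .
  qed
  have "iter_deriv vs (\<lambda>p. f (a + L p)) = (\<lambda>p. iter_deriv (map L vs) f (a + L p))" for vs
  proof (induction vs)
    case (Cons v vs)
    show ?case
      using frechet_derivative_at[OF diff[OF smooth_iter_deriv[OF f, of "map L vs"]], symmetric]
      by (simp add: Cons)
  qed simp
  then show ?thesis
    unfolding smooth_def using diff[OF smooth_iter_deriv[OF f]]
    by (metis differentiable_def)
qed

lemma frechet_derivative_eq_0_outside:
  assumes "closed A" and "\<And>x. x \<notin> A \<Longrightarrow> f x = 0" and "p \<notin> A"
  shows "frechet_derivative f (at p) v = 0"
proof -
  have "((\<lambda>_. 0) has_derivative (\<lambda>_. 0)) (at p)"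
    by simp
  then have "(f has_derivative (\<lambda>_. 0)) (at p)"
    using assms by (intro has_derivative_transform_within_open[of _ _ p UNIV "- A" f]) auto
  then show ?thesis
    by (metis frechet_derivative_at)
qed

lemma norm_fst_le_norm: "norm (fst p) \<le> norm p"
  and norm_snd_le_norm: "norm (snd p) \<le> norm p"
  by (metis norm_fst_le prod.collapse, metis norm_snd_le prod.collapse)

subsection \<open>Hermitian maps and left-invariant vector fields\<close>

locale hermitian =
  fixes \<Phi> :: "'e::fd_chilbert \<Rightarrow> 'e \<Rightarrow> 'f::fd_hilbert complexification"
  assumes hermitian: "hermitian_map \<Phi>"
begin

lemma add_left: "\<Phi> (x + y) z = \<Phi> x z + \<Phi> y z"
  and add_right: "\<Phi> x (y + z) = \<Phi> x y + \<Phi> x z"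
  and scaleC_left: "\<Phi> (c *\<^sub>C x) z = cscale c (\<Phi> x z)"
  and scaleC_right: "\<Phi> x (c *\<^sub>C z) = cscale (cnj c) (\<Phi> x z)"
  and commute: "\<Phi> y x = cconj (\<Phi> x y)"
  using hermitian unfolding hermitian_map_def by blast+

sublocale bounded_bilinear \<Phi>
proof (rule bounded_bilinear_fd_hilbert)
  have "cscale (complex_of_real r) z = r *\<^sub>R z" for r and z :: "'f complexification"
    by (simp add: cscale_def prod_eq_iff)
  then show "linear (\<lambda>x. \<Phi> x y)" and "linear (\<Phi> x)" for x y
    by (intro linearI; simp only: add_left add_right scaleR_scaleC scaleC_left scaleC_right
        complex_cnj_complex_of_real)+
qed

lemma nmult_eq: "nmult \<Phi> p q = p + (fst q, snd q + 2 *\<^sub>R snd (\<Phi> (fst p) (fst q)))"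
  by (simp add: nmult_def prod_eq_iff add.assoc)

lemma nmult_assoc: "nmult \<Phi> (nmult \<Phi> p q) r = nmult \<Phi> p (nmult \<Phi> q r)"
  by (simp add: nmult_def prod_eq_iff add_left add_right scaleR_add_right algebra_simps)

lemma bounded_linear_left_translation:
  "bounded_linear (\<lambda>q. (fst q, snd q + 2 *\<^sub>R snd (\<Phi> z (fst q))))"
  by (intro bounded_linear_Pair bounded_linear_add bounded_linear_fst bounded_linear_snd
      bounded_linear_scaleR_right bounded_linear_compose[OF bounded_linear_snd]
      bounded_linear_compose[OF bounded_linear_scaleR_right]
      bounded_linear_compose[OF bounded_linear_right])

text \<open>Left translation by \<open>p\<close> is affine, so the chain rule at the identity merely
  replaces \<open>w\<close> by its image under the linear part of the translation.\<close>

lemma left_field_eq: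
  assumes f: "f differentiable (at p)"
  shows "left_field \<Phi> w f p
    = frechet_derivative f (at p) (fst w, snd w + 2 *\<^sub>R snd (\<Phi> (fst p) (fst w)))"
proof -
  let ?T = "\<lambda>q. (fst q, snd q + 2 *\<^sub>R snd (\<Phi> (fst p) (fst q)))"
  have T0: "?T 0 = 0"
    by (simp add: zero_right zero_prod_def)
  have "((\<lambda>q. p + ?T q) has_derivative (\<lambda>v. 0 + ?T v)) (at 0)"
    by (intro has_derivative_add has_derivative_const bounded_linear_imp_has_derivative
        bounded_linear_left_translation)
  moreover have "(f has_derivative frechet_derivative f (at p)) (at (p + ?T 0))"
    unfolding T0 using f frechet_derivative_works by (metis add.right_neutral)
  ultimately have "((\<lambda>q. f (p + ?T q)) has_derivative
      (\<lambda>v. frechet_derivative f (at p) (0 + ?T v))) (at 0)"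
    by (rule has_derivative_compose)
  from frechet_derivative_at[OF this, symmetric] show ?thesis
    by (simp add: left_field_def nmult_eq)
qed

lemma left_invariant_id: "left_invariant_diff_op \<Phi> (\<lambda>f. f)"
proof -
  have "linear_diff_op (\<lambda>f :: 'e \<times> 'f \<Rightarrow> complex. f)"
    unfolding linear_diff_op_def
    by (intro exI[of _ 1] exI[of _ "\<lambda>_ _. 1"] exI[of _ "\<lambda>_. []"]) (auto simp: smooth_const)
  then show ?thesis
    by (simp add: left_invariant_diff_op_def)
qed

text \<open>This makes the growth condition of \<open>O_space\<close> applicable to vector fields.
  The vertical part is expanded in a basis of \<open>F\<close>, with coefficients linear in
  \<open>p\<close> and hence smooth.\<close>

lemma left_invariant_left_field: "left_invariant_diff_op \<Phi> (left_field \<Phi> w)"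
  unfolding left_invariant_diff_op_def
proof (intro conjI allI impI)
  obtain h :: "nat \<Rightarrow> 'f" where "bij_betw h {0..<card (onb :: 'f set)} onb"
    using ex_bij_betw_nat_finite[OF finite_onb] by blast
  then have h: "bij_betw h {..<card (onb :: 'f set)} onb"
    by (simp add: atLeast0LessThan)
  let ?n = "card (onb :: 'f set)"
  \<comment> \<open>Each index below \<open>?n\<close> carries one basis vector of \<open>F\<close>;
    the extra index \<open>?n\<close> carries the constant direction \<open>w\<close>.\<close>
  let ?a = "\<lambda>j (p :: 'e \<times> 'f). if j < ?n then complex_of_real (2 * (snd (\<Phi> (fst p) (fst w)) \<bullet> h j)) else 1"
  let ?v = "\<lambda>j. if j < ?n then [(0, h j)] else [w]"
  show "linear_diff_op (left_field \<Phi> w)"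
    unfolding linear_diff_op_def
  proof (intro exI[of _ "Suc ?n"] exI[of _ ?a] exI[of _ ?v] conjI allI impI)
    fix j
    have "bounded_linear (\<lambda>p :: 'e \<times> 'f. complex_of_real (2 * (snd (\<Phi> (fst p) (fst w)) \<bullet> h j)))"
      by (intro bounded_linear_compose[OF bounded_linear_of_real]
          bounded_linear_compose[OF bounded_linear_mult_right]
          bounded_linear_compose[OF bounded_linear_inner_left]
          bounded_linear_compose[OF bounded_linear_snd]
          bounded_linear_compose[OF bounded_linear_left] bounded_linear_fst)
    from smooth_bounded_linear[OF this, of 0] show "smooth (?a j)"
      by (cases "j < ?n") (simp_all add: smooth_const)
  next
    fix f :: "'e \<times> 'f \<Rightarrow> complex"
    assume f: "smooth f"
    show "left_field \<Phi> w f = (\<lambda>p. \<Sum>j<Suc ?n. ?a j p * iter_deriv (?v j) f p)"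
    proof
      fix p :: "'e \<times> 'f"
      let ?s = "snd (\<Phi> (fst p) (fst w))"
      interpret D: bounded_linear "frechet_derivative f (at p)"
        using smooth_has_derivative[OF f] by (rule has_derivative_bounded_linear)
      have "(fst w, snd w + 2 *\<^sub>R ?s) = w + (\<Sum>b\<in>onb. (2 * (?s \<bullet> b)) *\<^sub>R (0, b))"
      proof (rule prod_eqI)
        have "2 *\<^sub>R ?s = (\<Sum>b\<in>onb. (2 * (?s \<bullet> b)) *\<^sub>R b)"
          using onb_expansion[of "2 *\<^sub>R ?s"] by simp
        then show "snd (fst w, snd w + 2 *\<^sub>R ?s) = snd (w + (\<Sum>b\<in>onb. (2 * (?s \<bullet> b)) *\<^sub>R (0, b)))"
          by (simp add: snd_sum)
      qed (simp add: fst_sum)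
      then have "left_field \<Phi> w f p = frechet_derivative f (at p) w
          + (\<Sum>b\<in>onb. (2 * (?s \<bullet> b)) *\<^sub>R frechet_derivative f (at p) (0, b))"
        by (simp only: left_field_eq[OF smooth_differentiable[OF f]] D.add D.sum D.scaleR)
      also have "(\<Sum>b\<in>onb. (2 * (?s \<bullet> b)) *\<^sub>R frechet_derivative f (at p) (0, b))
          = (\<Sum>j<?n. (2 * (?s \<bullet> h j)) *\<^sub>R frechet_derivative f (at p) (0, h j))"
        by (rule sum.reindex_bij_betw[OF h, symmetric])
      also have "frechet_derivative f (at p) w + \<dots> = (\<Sum>j<Suc ?n. ?a j p * iter_deriv (?v j) f p)"
        by (simp add: scaleR_conv_of_real)
      finally show "left_field \<Phi> w f p = (\<Sum>j<Suc ?n. ?a j p * iter_deriv (?v j) f p)" .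
    qed
  qed
next
  fix f :: "'e \<times> 'f \<Rightarrow> complex" and q
  show "left_field \<Phi> w (\<lambda>p. f (nmult \<Phi> q p)) = (\<lambda>p. left_field \<Phi> w f (nmult \<Phi> q p))"
    by (simp add: fun_eq_iff left_field_def nmult_assoc)
qed

text \<open>The left-invariant fields of \<open>(0, b)\<close> are the Euclidean derivatives along
  \<open>F\<close>. A Euclidean derivative along \<open>E\<close> is a left-invariant one minus a
  vertical derivative whose coefficient grows linearly in \<open>p\<close>, which costs one further
  power of \<open>1 + norm p\<close>.\<close>

lemma O_space_growth:
  assumes "g \<in> O_space \<Phi> K"
  obtains C k where "0 \<le> C" and "\<And>p. norm (g p) \<le> C * (1 + norm p) ^ k"
    and "\<And>p w. norm (frechet_derivative g (at p) w) \<le> C * (1 + norm p) ^ k * norm w"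
proof -
  have g: "smooth g"
    using assms by (simp add: O_space_def)
  obtain k :: nat where k: "\<And>D. left_invariant_diff_op \<Phi> D \<Longrightarrow>
      bounded (range (\<lambda>p. D g p /\<^sub>R (1 + norm p) ^ k))"
    using assms by (auto simp: O_space_def)
  have bound: "\<exists>C\<ge>0. \<forall>p. norm (D g p) \<le> C * (1 + norm p) ^ k" if D: "left_invariant_diff_op \<Phi> D" for D
  proof -
    obtain C where C: "\<And>p. norm (D g p /\<^sub>R (1 + norm p) ^ k) \<le> C"
      using k[OF D] by (auto simp: bounded_iff)
    have pos: "0 < (1 + norm p) ^ k" for p :: "'e \<times> 'f"
      by (simp add: add_pos_nonneg)
    have "norm (D g p) \<le> C * (1 + norm p) ^ k" for p
    proof -
      have "norm (D g p) / (1 + norm p) ^ k \<le> C"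
        using C[of p] pos[of p] by (simp add: divide_inverse mult.commute)
      then show ?thesis
        using pos[of p] by (simp add: pos_divide_le_eq)
    qed
    moreover have "0 \<le> C"
      using order_trans[OF norm_ge_zero C] .
    ultimately show ?thesis
      by blast
  qed
  obtain C0 where C0: "0 \<le> C0" "\<And>p. norm (g p) \<le> C0 * (1 + norm p) ^ k"
    using bound[OF left_invariant_id] by blast
  obtain C where C: "\<And>w. 0 \<le> C w" "\<And>w p. norm (left_field \<Phi> w g p) \<le> C w * (1 + norm p) ^ k"
    using bound[OF left_invariant_left_field] by metis
  let ?D = "\<lambda>p. frechet_derivative g (at p)"
  have D: "bounded_linear (?D p)" for p
    using smooth_has_derivative[OF g] by (rule has_derivative_bounded_linear)
  obtain B where B: "0 < B" "\<And>x y. norm (\<Phi> x y) \<le> norm x * norm y * B"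
    using pos_bounded by blast
  define C1 where "C1 = (\<Sum>b\<in>(onb :: 'f set). C (0, b))"
  have C1: "0 \<le> C1"
    unfolding C1_def using C by (simp add: sum_nonneg)
  have snd_part: "norm (?D p (0, u)) \<le> C1 * (1 + norm p) ^ k * norm u" for p u
  proof -
    have "linear (\<lambda>u. ?D p (0, u))"
      using bounded_linear_compose[OF D bounded_linear_Pair[OF bounded_linear_zero bounded_linear_ident]]
      by (rule bounded_linear.linear)
    then have "norm (?D p (0, u)) \<le> (\<Sum>b\<in>onb. C (0, b) * (1 + norm p) ^ k) * norm u"
    proof (rule norm_linear_le_onb)
      show "norm (?D p (0, b)) \<le> C (0, b) * (1 + norm p) ^ k" for b
        using C(2)[of "(0, b)" p] by (simp add: left_field_eq smooth_differentiable[OF g] zero_right)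
    qed
    then show ?thesis
      by (simp add: C1_def sum_distrib_right)
  qed
  \<comment> \<open>\<open>C1\<close> bounds the vertical derivatives, and \<open>2 * B\<close> the
    size of the vertical correction relative to \<open>norm p\<close>.\<close>
  define C2 where "C2 = (\<Sum>b\<in>(onb :: 'e set). C (b, 0) + 2 * C1 * B)"
  have C2: "0 \<le> C2"
    unfolding C2_def using C C1 B by (intro sum_nonneg) auto
  have fst_part: "norm (?D p (v, 0)) \<le> C2 * (1 + norm p) ^ Suc k * norm v" for p v
  proof -
    have "linear (\<lambda>v. ?D p (v, 0))"
      using bounded_linear_compose[OF D bounded_linear_Pair[OF bounded_linear_ident bounded_linear_zero]]
      by (rule bounded_linear.linear)
    then have "norm (?D p (v, 0)) \<le> (\<Sum>b\<in>onb. (C (b, 0) + 2 * C1 * B) * (1 + norm p) ^ Suc k) * norm v"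
    proof (rule norm_linear_le_onb)
      fix b :: 'e
      assume b: "b \<in> onb"
      let ?u = "2 *\<^sub>R snd (\<Phi> (fst p) b)"
      have "norm ?u \<le> 2 * (norm (fst p) * B)"
        using B(2)[of "fst p" b] norm_snd_le_norm[of "\<Phi> (fst p) b"] b by (simp add: norm_onb)
      also have "\<dots> \<le> 2 * (norm p * B)"
        using B(1) norm_fst_le_norm[of p] by simp
      finally have u: "norm ?u \<le> 2 * (norm p * B)" .
      have "left_field \<Phi> (b, 0) g p = ?D p ((b, 0) + (0, ?u))"
        by (simp add: left_field_eq smooth_differentiable[OF g])
      then have "?D p (b, 0) = left_field \<Phi> (b, 0) g p - ?D p (0, ?u)"
        by (simp only: linear_simps[OF D]) simp
      then have "norm (?D p (b, 0)) \<le> norm (left_field \<Phi> (b, 0) g p) + norm (?D p (0, ?u))"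
        by (simp add: norm_triangle_ineq4)
      also have "\<dots> \<le> C (b, 0) * (1 + norm p) ^ k + C1 * (1 + norm p) ^ k * (2 * (norm p * B))"
        using u C1
        by (intro add_mono C order_trans[OF snd_part] mult_left_mono) auto
      also have "\<dots> \<le> (C (b, 0) + 2 * C1 * B) * (1 + norm p) ^ Suc k"
      proof -
        have "C (b, 0) + C1 * (2 * (norm p * B)) \<le> (C (b, 0) + 2 * C1 * B) * (1 + norm p)"
          using C(1)[of "(b, 0)"] C1 B(1) by (simp add: algebra_simps)
        from mult_right_mono[OF this, of "(1 + norm p) ^ k"] show ?thesis
          by (simp add: algebra_simps)
      qed
      finally show "norm (?D p (b, 0)) \<le> (C (b, 0) + 2 * C1 * B) * (1 + norm p) ^ Suc k" .
    qed
    then show ?thesis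
      by (simp add: C2_def sum_distrib_right)
  qed
  show thesis
  proof
    let ?C = "C0 + C1 + C2"
    show "0 \<le> ?C"
      using C0 C1 C2 by simp
    fix p :: "'e \<times> 'f"
    have mono: "(1 + norm p) ^ k \<le> (1 + norm p) ^ Suc k"
      by (intro power_increasing) auto
    show "norm (g p) \<le> ?C * (1 + norm p) ^ Suc k"
      using C0 C1 C2 mono by (intro order_trans[OF C0(2)] mult_mono) auto
    fix w :: "'e \<times> 'f"
    have "?D p w = ?D p ((fst w, 0) + (0, snd w))"
      by simp
    then have "norm (?D p w) \<le> norm (?D p (fst w, 0)) + norm (?D p (0, snd w))"
      by (simp only: linear_simps[OF D] norm_triangle_ineq)
    also have "\<dots> \<le> C2 * (1 + norm p) ^ Suc k * norm w + C1 * (1 + norm p) ^ Suc k * norm w"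
      using C1 C2 mono norm_fst_le_norm[of w] norm_snd_le_norm[of w]
      by (intro add_mono order_trans[OF fst_part] order_trans[OF snd_part] mult_mono) auto
    also have "\<dots> \<le> ?C * (1 + norm p) ^ Suc k * norm w"
      using C0 by (simp add: algebra_simps)
    finally show "norm (?D p w) \<le> ?C * (1 + norm p) ^ Suc k * norm w" .
  qed
qed

end

subsection \<open>The Fourier--Laplace transform of a test function\<close>

text \<open>\<open>A\<close> may be larger than the support. Fixing it in advance keeps derivatives
  of \<open>\<psi>\<close> and its products with linear functions over one set, so that one bound on
  \<open>A\<close> serves them all.\<close>

definition test_fun :: "'a::real_normed_vector set \<Rightarrow> ('a \<Rightarrow> complex) \<Rightarrow> bool" where
  "test_fun A \<psi> \<longleftrightarrow> smooth \<psi> \<and> (\<forall>l. l \<notin> A \<longrightarrow> \<psi> l = 0)"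

text \<open>This is \<open>exp (-i (l . (x + i y)))\<close>, with the inner product extended complex
  bilinearly.\<close>

definition fl_kernel :: "'a::real_inner \<Rightarrow> 'a \<Rightarrow> 'a \<Rightarrow> complex" where
  "fl_kernel x y l = exp (of_real (l \<bullet> y) - \<i> * of_real (l \<bullet> x))"

text \<open>The Fourier transform of \<open>\<psi>\<close>, extended to an entire function and evaluated at \<open>x + i y\<close>.\<close>

definition fl :: "('a::fd_hilbert \<Rightarrow> complex) \<Rightarrow> 'a \<Rightarrow> 'a \<Rightarrow> complex" where
  "fl \<psi> x y = (\<integral>l. \<psi> l * fl_kernel x y l \<partial>hborel)"

text \<open>Up to the factor \<open>-i\<close>, this is what a derivative of the Fourier kernel in
  \<open>x\<close> along \<open>u\<close> brings down.\<close>

definition inner_mult :: "'a::real_inner \<Rightarrow> ('a \<Rightarrow> complex) \<Rightarrow> 'a \<Rightarrow> complex" where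
  "inner_mult u \<psi> l = of_real (l \<bullet> u) * \<psi> l"

lemma norm_fl_kernel: "norm (fl_kernel x y l) = exp (l \<bullet> y)"
  by (simp add: fl_kernel_def)

lemma continuous_on_fl_kernel [continuous_intros]: "continuous_on S (fl_kernel x y)"
  unfolding fl_kernel_def by (intro continuous_intros)

lemma test_fun_continuous_on: "test_fun A \<psi> \<Longrightarrow> continuous_on S \<psi>"
  by (simp add: test_fun_def smooth_continuous_on)

lemma test_fun_inner_mult:
  assumes "test_fun A \<psi>"
  shows "test_fun A (inner_mult u \<psi>)"
proof -
  have "bounded_linear (\<lambda>l. complex_of_real (l \<bullet> u))"
    by (intro bounded_linear_compose[OF bounded_linear_of_real] bounded_linear_inner_left)
  from smooth_mult[OF smooth_bounded_linear[OF this, of 0]] assms show ?thesis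
    by (simp add: test_fun_def inner_mult_def[abs_def])
qed

lemma test_fun_derivative:
  assumes "closed A" and "test_fun A \<psi>"
  shows "test_fun A (\<lambda>p. frechet_derivative \<psi> (at p) u)"
proof -
  have \<psi>: "smooth \<psi>" "\<And>l. l \<notin> A \<Longrightarrow> \<psi> l = 0"
    using assms(2) by (simp_all add: test_fun_def)
  show ?thesis
    unfolding test_fun_def
    using smooth_frechet_derivative[OF \<psi>(1)] frechet_derivative_eq_0_outside[OF assms(1) \<psi>(2)]
    by simp
qed

lemma compactly_supported_bounded:
  fixes f :: "'a::topological_space \<Rightarrow> 'b::real_normed_vector"
  assumes "compact A" and "continuous_on UNIV f" and "\<And>l. l \<notin> A \<Longrightarrow> f l = 0"
  obtains B where "0 \<le> B" and "\<And>l. norm (f l) \<le> B * indicator A l"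
proof -
  have "bounded (f ` A)"
    by (intro compact_imp_bounded compact_continuous_image assms(1)
        continuous_on_subset[OF assms(2)]) auto
  then obtain B where "B > 0" "\<And>l. l \<in> A \<Longrightarrow> norm (f l) \<le> B"
    by (auto simp: bounded_pos)
  with that[of B] assms(3) show thesis
    by (auto simp: indicator_def)
qed

lemma integrable_indicator_compact:
  assumes "compact A"
  shows "integrable hborel (indicator A :: 'a::fd_hilbert \<Rightarrow> real)"
proof (rule integrable_real_indicator)
  show "A \<in> sets hborel"
    using assms by (simp add: borel_closed compact_imp_closed)
  show "emeasure hborel A < \<infinity>"
    using assms by (intro emeasure_hborel_bounded compact_imp_bounded)
qed

lemma integrable_compactly_supported:
  fixes f :: "'a::fd_hilbert \<Rightarrow> 'b::{banach, second_countable_topology}"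
  assumes "compact A" and "continuous_on UNIV f" and "\<And>l. l \<notin> A \<Longrightarrow> f l = 0"
  shows "integrable hborel f"
proof -
  obtain B where B: "0 \<le> B" "\<And>l. norm (f l) \<le> B * indicator A l"
    using compactly_supported_bounded[OF assms] by blast
  show ?thesis
  proof (rule Bochner_Integration.integrable_bound)
    show "integrable hborel (\<lambda>l. B * indicator A l)"
      by (intro integrable_mult_right integrable_indicator_compact assms(1))
    show "f \<in> borel_measurable hborel"
      using assms(2) by (rule continuous_on_borel_measurable_hborel)
    show "AE l in hborel. norm (f l) \<le> norm (B * indicator A l)"
      using B by simp
  qed
qed

text \<open>Translation invariance makes the integral of \<open>f (l + t *\<^sub>R u)\<close>
  constant in \<open>t\<close>; the integral in question is its derivative at
  \<open>t = 0\<close>.\<close>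

lemma integral_directional_derivative_eq_0:
  fixes f :: "'a::fd_hilbert \<Rightarrow> complex"
  assumes A: "compact A" and supp: "\<And>l. l \<notin> A \<Longrightarrow> f l = 0"
    and deriv: "\<And>l. (f has_derivative D l) (at l)"
    and cont: "continuous_on UNIV (\<lambda>l. D l u)"
  shows "(\<integral>l. D l u \<partial>hborel) = 0"
proof -
  have f: "continuous_on UNIV f"
    using has_derivative_continuous[OF deriv] by (simp add: continuous_at_imp_continuous_on)
  have "D l u = 0" if "l \<notin> A" for l
    using frechet_derivative_eq_0_outside[where f = f and v = u, OF compact_imp_closed[OF A] supp that]
    by (simp add: frechet_derivative_at[OF deriv, symmetric])
  from compactly_supported_bounded[OF A cont this]
  obtain B where B: "0 \<le> B" "\<And>l. norm (D l u) \<le> B * indicator A l"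
    by blast
  \<comment> \<open>A compact set containing the supports of all translates with
    \<open>\<bar>t\<bar> \<le> 1\<close>, so that a multiple of its indicator dominates the
    derivatives.\<close>
  define A' where "A' = (\<lambda>(l, t). l - t *\<^sub>R u) ` (A \<times> {-1..1})"
  have A': "compact A'"
    unfolding A'_def case_prod_unfold
    by (intro compact_continuous_image compact_Times A compact_Icc continuous_intros)
  have "((\<lambda>t. \<integral>l. f (l + t *\<^sub>R u) \<partial>hborel) has_derivative
      (\<lambda>h. \<integral>l. D (l + 0 *\<^sub>R u) (h *\<^sub>R u) \<partial>hborel)) (at (0::real))"
  proof (rule has_derivative_integral_dominated[of 1 _ _ _ "\<lambda>t l h. D (l + t *\<^sub>R u) (h *\<^sub>R u)"
        "\<lambda>l. B * indicator A' l"])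
    fix t :: real
    assume t: "t \<in> ball 0 1"
    have mem: "l \<in> A'" if "l + t *\<^sub>R u \<in> A" for l
    proof -
      have "l = (\<lambda>(l, t). l - t *\<^sub>R u) (l + t *\<^sub>R u, t)"
        by simp
      then show ?thesis
        unfolding A'_def using that t by (intro image_eqI[where x = "(l + t *\<^sub>R u, t)"]) auto
    qed
    show "integrable hborel (\<lambda>l. f (l + t *\<^sub>R u))"
      by (rule integrable_compactly_supported[OF A'])
        (use mem supp in \<open>auto intro!: continuous_on_compose2[OF f] continuous_intros\<close>)
    fix l h
    show "((\<lambda>t. f (l + t *\<^sub>R u)) has_derivative (\<lambda>h. D (l + t *\<^sub>R u) (h *\<^sub>R u))) (at t)"
      by (rule has_derivative_compose[OF _ deriv]) (auto intro!: derivative_eq_intros)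
    have "norm (D (l + t *\<^sub>R u) (h *\<^sub>R u)) = norm (D (l + t *\<^sub>R u) u) * norm h"
      using has_derivative_bounded_linear[OF deriv] by (simp add: linear_simps)
    also have "\<dots> \<le> B * indicator A' l * norm h"
    proof (rule mult_right_mono)
      show "norm (D (l + t *\<^sub>R u) u) \<le> B * indicator A' l"
      proof (rule order_trans[OF B(2)], rule mult_left_mono[OF _ B(1)])
        show "indicator A (l + t *\<^sub>R u) \<le> (indicator A' l :: real)"
          using mem[of l] by (auto simp: indicator_def)
      qed
    qed simp
    finally show "norm (D (l + t *\<^sub>R u) (h *\<^sub>R u)) \<le> B * indicator A' l * norm h" .
  qed (auto intro: integrable_indicator_compact A')
  moreover have "(\<lambda>t. \<integral>l. f (l + t *\<^sub>R u) \<partial>hborel) = (\<lambda>t. \<integral>l. f l \<partial>hborel)"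
    by (simp add: hborel_translate_continuous[OF f])
  ultimately have "((\<lambda>t. \<integral>l. f l \<partial>hborel) has_derivative
      (\<lambda>h. \<integral>l. D l (h *\<^sub>R u) \<partial>hborel)) (at (0::real))"
    by simp
  from has_derivative_unique[OF this has_derivative_const] have "(\<integral>l. D l (1 *\<^sub>R u) \<partial>hborel) = 0"
    by metis
  then show ?thesis
    by simp
qed

section \<open>Decay and holomorphy of the Fourier-Laplace transform\<close>

lemma integrable_fl:
  assumes "compact A" and "test_fun A \<psi>"
  shows "integrable hborel (\<lambda>l. \<psi> l * fl_kernel x y l)"
  using assms
  by (intro integrable_compactly_supported[OF assms(1)] continuous_on_mult test_fun_continuous_on
      continuous_on_fl_kernel) (auto simp: test_fun_def)

lemma has_derivative_complex_exp:
  fixes f :: "'a::real_normed_vector \<Rightarrow> complex"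
  assumes "(f has_derivative f') (at x)"
  shows "((\<lambda>x. exp (f x)) has_derivative (\<lambda>h. f' h * exp (f x))) (at x)"
  using has_derivative_compose[OF assms DERIV_exp[unfolded has_field_derivative_def]]
  by (simp add: mult.commute)

lemma fl_kernel_has_derivative:
  "(fl_kernel x y has_derivative
    (\<lambda>h. (of_real (h \<bullet> y) - \<i> * of_real (h \<bullet> x)) * fl_kernel x y l)) (at l)"
  unfolding fl_kernel_def
  by (intro has_derivative_complex_exp bounded_linear_imp_has_derivative bounded_linear_sub
      bounded_linear_compose[OF bounded_linear_mult_right]
      bounded_linear_compose[OF bounded_linear_of_real] bounded_linear_inner_left)

text \<open>Integration by parts: the derivative along \<open>u\<close> of \<open>\<psi>\<close>
  times the kernel integrates to 0, and the kernel contributes the factor \<open>?c\<close>.\<close>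

lemma fl_derivative:
  assumes A: "compact A" and \<psi>: "test_fun A \<psi>"
  shows "fl (\<lambda>l. frechet_derivative \<psi> (at l) u) x y
    = (\<i> * of_real (u \<bullet> x) - of_real (u \<bullet> y)) * fl \<psi> x y"
proof -
  let ?c = "of_real (u \<bullet> y) - \<i> * of_real (u \<bullet> x)" and ?D = "\<lambda>l. frechet_derivative \<psi> (at l)"
  have D: "test_fun A (\<lambda>l. ?D l u)"
    using A \<psi> by (simp add: test_fun_derivative compact_imp_closed)
  have "(\<integral>l. \<psi> l * (?c * fl_kernel x y l) + ?D l u * fl_kernel x y l \<partial>hborel) = 0"
  proof (rule integral_directional_derivative_eq_0[OF A, where u = u and f = "\<lambda>l. \<psi> l * fl_kernel x y l"
        and D = "\<lambda>l u. \<psi> l * ((of_real (u \<bullet> y) - \<i> * of_real (u \<bullet> x)) * fl_kernel x y l)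
          + ?D l u * fl_kernel x y l"])
    show "((\<lambda>l. \<psi> l * fl_kernel x y l) has_derivative
        (\<lambda>u. \<psi> l * ((of_real (u \<bullet> y) - \<i> * of_real (u \<bullet> x)) * fl_kernel x y l)
          + ?D l u * fl_kernel x y l)) (at l)" for l
      using \<psi> by (intro has_derivative_mult fl_kernel_has_derivative smooth_has_derivative)
        (simp add: test_fun_def)
    show "continuous_on UNIV (\<lambda>l. \<psi> l * (?c * fl_kernel x y l) + ?D l u * fl_kernel x y l)"
      by (intro continuous_intros test_fun_continuous_on[OF \<psi>] test_fun_continuous_on[OF D])
  qed (use \<psi> in \<open>simp add: test_fun_def\<close>)
  moreover have "(\<integral>l. \<psi> l * (?c * fl_kernel x y l) + ?D l u * fl_kernel x y l \<partial>hborel)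
      = (\<integral>l. ?c * (\<psi> l * fl_kernel x y l) \<partial>hborel) + (\<integral>l. ?D l u * fl_kernel x y l \<partial>hborel)"
    using integrable_mult_right[OF integrable_fl[OF A \<psi>, of x y], of ?c] integrable_fl[OF A D, of x y]
    by (simp add: mult.left_commute)
  ultimately have "?c * fl \<psi> x y + fl (\<lambda>l. ?D l u) x y = 0"
    by (simp add: fl_def)
  then show ?thesis
    by (simp add: algebra_simps eq_neg_iff_add_eq_0)
qed

text \<open>A Paley-Wiener estimate. \<open>M\<close> is any upper bound of
  \<open>l \<bullet> y\<close> on \<open>A\<close> and may be negative, which is where the later
  Gaussian decay comes from. Each power of \<open>1 + l1norm x\<close> is bought by one derivative
  of \<open>\<psi>\<close> along every basis vector, at the price of one power of
  \<open>1 + norm y\<close>.\<close>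

lemma fl_decay:
  assumes A: "compact A" and \<psi>: "test_fun A \<psi>"
  shows "\<exists>C\<ge>0. \<forall>x y M. (\<forall>l\<in>A. l \<bullet> y \<le> M) \<longrightarrow>
    (1 + l1norm x) ^ N * norm (fl \<psi> x y) \<le> C * (1 + norm y) ^ N * exp M"
  using \<psi>
proof (induction N arbitrary: \<psi>)
  case 0
  have int: "integrable hborel (\<lambda>l. norm (\<psi> l))"
    using 0 by (intro integrable_compactly_supported[OF A] continuous_intros test_fun_continuous_on)
      (auto simp: test_fun_def)
  have "norm (fl \<psi> x y) \<le> (\<integral>l. norm (\<psi> l) \<partial>hborel) * exp M" if M: "\<forall>l\<in>A. l \<bullet> y \<le> M" for x y M
  proof -
    have "norm (fl \<psi> x y) \<le> (\<integral>l. norm (\<psi> l * fl_kernel x y l) \<partial>hborel)"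
      unfolding fl_def by (rule integral_norm_bound)
    also have "\<dots> \<le> (\<integral>l. norm (\<psi> l) * exp M \<partial>hborel)"
    proof (rule integral_mono)
      show "norm (\<psi> l * fl_kernel x y l) \<le> norm (\<psi> l) * exp M" for l
        using M 0 by (cases "l \<in> A") (auto simp: norm_mult norm_fl_kernel mult_left_mono test_fun_def)
    qed (use int integrable_fl[OF A 0] in auto)
    finally show ?thesis
      by simp
  qed
  then show ?case
    by (intro exI[of _ "\<integral>l. norm (\<psi> l) \<partial>hborel"]) simp
next
  case (Suc N)
  let ?D = "\<lambda>u l. frechet_derivative \<psi> (at l) u"
  have D: "test_fun A (?D u)" for u
    using A Suc.prems by (simp add: test_fun_derivative compact_imp_closed)
  obtain C where C: "0 \<le> C" "\<And>x y M. \<forall>l\<in>A. l \<bullet> y \<le> M \<Longrightarrow>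
      (1 + l1norm x) ^ N * norm (fl \<psi> x y) \<le> C * (1 + norm y) ^ N * exp M"
    using Suc.IH[OF Suc.prems] by blast
  obtain C' where C': "\<And>u. 0 \<le> C' u" "\<And>u x y M. \<forall>l\<in>A. l \<bullet> y \<le> M \<Longrightarrow>
      (1 + l1norm x) ^ N * norm (fl (?D u) x y) \<le> C' u * (1 + norm y) ^ N * exp M"
    using Suc.IH[OF D] by metis
  let ?K = "C + (\<Sum>b\<in>onb. C' b + C)"
  have "0 \<le> ?K"
    using C(1) C'(1) by (intro add_nonneg_nonneg sum_nonneg) auto
  moreover have "(1 + l1norm x) ^ Suc N * norm (fl \<psi> x y) \<le> ?K * (1 + norm y) ^ Suc N * exp M"
    if M: "\<forall>l\<in>A. l \<bullet> y \<le> M" for x y :: 'a and M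
  proof -
    let ?E = "(1 + norm y) ^ Suc N * exp M" and ?P = "(1 + l1norm x) ^ N"
    have P: "0 \<le> ?P"
      by simp
    have E: "(1 + norm y) ^ N * exp M \<le> ?E" "(1 + norm y) ^ N * exp M * norm y \<le> ?E"
      by (simp_all add: algebra_simps mult_left_mono)
    have "?P * (\<bar>x \<bullet> b\<bar> * norm (fl \<psi> x y)) \<le> (C' b + C) * ?E" if b: "b \<in> onb" for b
    proof -
      \<comment> \<open>Solving \<open>fl_derivative\<close> for the term with \<open>x\<close>
        leaves the transform of a derivative and a multiple of the transform itself by
        \<open>b \<bullet> y\<close>, which is at most \<open>norm y\<close> in size.\<close>
      have "\<bar>x \<bullet> b\<bar> * norm (fl \<psi> x y) = norm (\<i> * of_real (b \<bullet> x) * fl \<psi> x y)"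
        by (simp add: norm_mult inner_commute)
      also have "\<i> * of_real (b \<bullet> x) * fl \<psi> x y = fl (?D b) x y + of_real (b \<bullet> y) * fl \<psi> x y"
        by (simp add: fl_derivative[OF A Suc.prems] algebra_simps)
      also have "norm \<dots> \<le> norm (fl (?D b) x y) + norm y * norm (fl \<psi> x y)"
        using Cauchy_Schwarz_ineq2[of b y] norm_onb[OF b]
        by (intro order_trans[OF norm_triangle_ineq] add_left_mono)
          (simp add: norm_mult mult_right_mono)
      finally have "?P * (\<bar>x \<bullet> b\<bar> * norm (fl \<psi> x y))
          \<le> ?P * norm (fl (?D b) x y) + (?P * norm (fl \<psi> x y)) * norm y"
        using mult_left_mono[OF _ P] by (fastforce simp: algebra_simps)
      also have "\<dots> \<le> C' b * (1 + norm y) ^ N * exp M + (C * (1 + norm y) ^ N * exp M) * norm y"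
        by (intro add_mono mult_right_mono C C' M) auto
      also have "\<dots> \<le> C' b * ?E + C * ?E"
        using mult_left_mono[OF E(1) C'(1)[of b]] mult_left_mono[OF E(2) C(1)]
        by (simp only: mult.assoc add_mono)
      finally show ?thesis
        by (simp add: algebra_simps)
    qed
    then have "(\<Sum>b\<in>onb. ?P * (\<bar>x \<bullet> b\<bar> * norm (fl \<psi> x y))) \<le> (\<Sum>b\<in>onb. (C' b + C) * ?E)"
      by (rule sum_mono)
    moreover have "?P * norm (fl \<psi> x y) \<le> C * ?E"
      using C(2)[OF M, of x] mult_left_mono[OF E(1) C(1)] by (simp add: mult.assoc)
    moreover have "(1 + l1norm x) ^ Suc N * norm (fl \<psi> x y)
        = ?P * norm (fl \<psi> x y) + (\<Sum>b\<in>onb. ?P * (\<bar>x \<bullet> b\<bar> * norm (fl \<psi> x y)))"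
      by (simp add: l1norm_def sum_distrib_left sum_distrib_right algebra_simps)
    moreover have "?K * (1 + norm y) ^ Suc N * exp M = C * ?E + (\<Sum>b\<in>onb. (C' b + C) * ?E)"
      by (simp only: mult.assoc distrib_right sum_distrib_right)
    ultimately show ?thesis
      by linarith
  qed
  ultimately show ?case
    by blast
qed

text \<open>For an increment \<open>h = (dx, dy)\<close> the two terms together insert the factor
  \<open>-i (l . (dx + i dy))\<close> under the integral: this is holomorphy in
  \<open>x + i y\<close>, stated for real variables.\<close>

lemma fl_has_derivative:
  assumes A: "compact A" and \<psi>: "test_fun A \<psi>"
  shows "((\<lambda>p. fl \<psi> (fst p) (snd p)) has_derivative
    (\<lambda>h. fl (inner_mult (snd h) \<psi>) (fst p) (snd p) - \<i> * fl (inner_mult (fst h) \<psi>) (fst p) (snd p)))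
    (at p)"
proof -
  let ?c = "\<lambda>h l. of_real (l \<bullet> snd h) - \<i> * of_real (l \<bullet> fst h) :: complex"
  let ?D = "\<lambda>p l h. \<psi> l * (?c h l * fl_kernel (fst p) (snd p) l)"
  let ?B = "\<lambda>l. norm (\<psi> l) * (2 * norm l * exp (norm l * (norm p + 1)))"
  have "((\<lambda>p. \<integral>l. \<psi> l * fl_kernel (fst p) (snd p) l \<partial>hborel) has_derivative
      (\<lambda>h. \<integral>l. ?D p l h \<partial>hborel)) (at p)"
  proof (rule has_derivative_integral_dominated[of 1 _ _ _ ?D ?B])
    show "integrable hborel ?B"
      using \<psi> by (intro integrable_compactly_supported[OF A] continuous_intros test_fun_continuous_on)
        (auto simp: test_fun_def)
    fix q :: "'a \<times> 'a" and l :: 'a and h :: "'a \<times> 'a"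
    assume q: "q \<in> ball p 1"
    show "((\<lambda>p. \<psi> l * fl_kernel (fst p) (snd p) l) has_derivative ?D q l) (at q)"
      unfolding fl_kernel_def
      by (intro has_derivative_mult_right has_derivative_complex_exp
          bounded_linear_imp_has_derivative bounded_linear_sub
          bounded_linear_compose[OF bounded_linear_mult_right]
          bounded_linear_compose[OF bounded_linear_of_real]
          bounded_linear_compose[OF bounded_linear_inner_right] bounded_linear_fst bounded_linear_snd)
    have "norm q \<le> norm p + 1"
      using q norm_triangle_ineq2[of q p] by (simp add: dist_norm norm_minus_commute)
    then have "norm (snd q) \<le> norm p + 1"
      using norm_snd_le_norm[of q] by linarith
    then have "l \<bullet> snd q \<le> norm l * (norm p + 1)"
      by (intro order_trans[OF norm_cauchy_schwarz] mult_left_mono) auto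
    moreover have "norm (?c h l) \<le> 2 * norm l * norm h"
    proof -
      have "norm (?c h l) \<le> \<bar>l \<bullet> snd h\<bar> + \<bar>l \<bullet> fst h\<bar>"
        by (rule order_trans[OF norm_triangle_ineq4]) (simp add: norm_mult)
      also have "\<dots> \<le> norm l * norm h + norm l * norm h"
        by (intro add_mono order_trans[OF Cauchy_Schwarz_ineq2] mult_left_mono norm_fst_le_norm
            norm_snd_le_norm) auto
      finally show ?thesis
        by simp
    qed
    ultimately have "norm (?c h l) * exp (l \<bullet> snd q) \<le> 2 * norm l * norm h * exp (norm l * (norm p + 1))"
      by (intro mult_mono) auto
    from mult_left_mono[OF this norm_ge_zero[of "\<psi> l"]]
    show "norm (?D q l h) \<le> ?B l * norm h"
      by (simp add: norm_mult norm_fl_kernel mult_ac)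
  qed (auto intro: integrable_fl[OF A \<psi>])
  moreover have "(\<integral>l. ?D p l h \<partial>hborel) = fl (inner_mult (snd h) \<psi>) (fst p) (snd p)
      - \<i> * fl (inner_mult (fst h) \<psi>) (fst p) (snd p)" for h
  proof -
    note int = integrable_fl[OF A test_fun_inner_mult[OF \<psi>]]
    have "fl (inner_mult (snd h) \<psi>) (fst p) (snd p) - \<i> * fl (inner_mult (fst h) \<psi>) (fst p) (snd p)
      = (\<integral>l. inner_mult (snd h) \<psi> l * fl_kernel (fst p) (snd p) l
          - \<i> * (inner_mult (fst h) \<psi> l * fl_kernel (fst p) (snd p) l) \<partial>hborel)"
      unfolding fl_def
      by (subst Bochner_Integration.integral_diff) (auto intro: int integrable_mult_right)
    then show ?thesis
      by (simp add: inner_mult_def algebra_simps)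
  qed
  ultimately show ?thesis
    by (simp add: fl_def)
qed

lemma linear_fl_inner_mult:
  assumes A: "compact A" and \<psi>: "test_fun A \<psi>"
  shows "linear (\<lambda>u. fl (inner_mult u \<psi>) x y)"
proof (rule linearI)
  note int = integrable_fl[OF A test_fun_inner_mult[OF \<psi>]]
  show "fl (inner_mult (u + v) \<psi>) x y = fl (inner_mult u \<psi>) x y + fl (inner_mult v \<psi>) x y" for u v
    unfolding fl_def Bochner_Integration.integral_add[OF int int, symmetric]
    by (simp add: inner_mult_def inner_add_right algebra_simps)
  show "fl (inner_mult (r *\<^sub>R u) \<psi>) x y = r *\<^sub>R fl (inner_mult u \<psi>) x y" for r u
    unfolding fl_def integral_scaleR_right[symmetric]
    by (simp add: inner_mult_def scaleR_conv_of_real mult.assoc)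
qed

text \<open>In the derivative of a CR test function the direction \<open>u\<close> varies with the
  point, so the constant has to be uniform in \<open>u\<close>; linearity reduces this to the
  basis.\<close>

lemma fl_inner_mult_decay:
  assumes A: "compact A" and \<psi>: "test_fun A \<psi>"
  shows "\<exists>C\<ge>0. \<forall>x y M u. (\<forall>l\<in>A. l \<bullet> y \<le> M) \<longrightarrow>
    (1 + l1norm x) ^ N * norm (fl (inner_mult u \<psi>) x y) \<le> C * (1 + norm y) ^ N * exp M * norm u"
proof -
  obtain C where C: "\<And>u. 0 \<le> C u" "\<And>u x y M. \<forall>l\<in>A. l \<bullet> y \<le> M \<Longrightarrow>
      (1 + l1norm x) ^ N * norm (fl (inner_mult u \<psi>) x y) \<le> C u * (1 + norm y) ^ N * exp M"
    using fl_decay[OF A test_fun_inner_mult[OF \<psi>]] by metis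
  have "(1 + l1norm x) ^ N * norm (fl (inner_mult u \<psi>) x y)
      \<le> (\<Sum>b\<in>onb. C b) * (1 + norm y) ^ N * exp M * norm u" if M: "\<forall>l\<in>A. l \<bullet> y \<le> M" for x y M u
  proof -
    let ?L = "\<lambda>u. (1 + l1norm x) ^ N *\<^sub>R fl (inner_mult u \<psi>) x y"
    have P: "0 \<le> (1 + l1norm x) ^ N"
      by simp
    have "linear ?L"
      by (intro linear_compose_scale_right linear_fl_inner_mult[OF A \<psi>])
    then have "norm (?L u) \<le> (\<Sum>b\<in>onb. C b * (1 + norm y) ^ N * exp M) * norm u"
      by (rule norm_linear_le_onb) (use C(2)[OF M] P in \<open>simp add: abs_of_nonneg\<close>)
    then show ?thesis
      using P by (simp add: sum_distrib_right abs_of_nonneg)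
  qed
  moreover have "0 \<le> (\<Sum>b\<in>onb. C b)"
    using C(1) by (simp add: sum_nonneg)
  ultimately show ?thesis
    by blast
qed

subsection \<open>CR functions paired with exponentials\<close>

lemma linear_scaleC_left: "linear (\<lambda>c. c *\<^sub>C (v :: 'a::fd_chilbert))"
proof (rule linearI)
  show "(r *\<^sub>R c) *\<^sub>C v = r *\<^sub>R (c *\<^sub>C v)" for r c
    by (simp add: scaleR_scaleC scaleC_scaleC scaleC_complex_def)
qed (rule scaleC_add_left)

lemma bounded_linear_scaleC_left: "bounded_linear (\<lambda>c. c *\<^sub>C (v :: 'a::fd_chilbert))"
  by (intro bounded_linear_fd_hilbert linear_scaleC_left)

text \<open>A Peetre-type inequality: it makes weighted bounds uniform over bounded shifts
  \<open>s\<close>.\<close>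

lemma one_plus_l1norm_translate:
  "1 + l1norm x \<le> (1 + l1norm (x + s)) * (1 + l1norm s)"
proof -
  have "l1norm x \<le> l1norm (x + s) + l1norm (- s)"
    using l1norm_triangle[of "x + s" "- s"] by simp
  also have "l1norm (- s) = l1norm s"
    by (simp add: l1norm_def)
  finally have "l1norm x \<le> l1norm (x + s) + l1norm s" .
  moreover have "0 \<le> l1norm (x + s) * l1norm s"
    by simp
  ultimately show ?thesis
    unfolding distrib_left distrib_right by linarith
qed

lemma partial_fourier_test_eq_fl:
  fixes \<phi> :: "'a::fd_chilbert \<times> ('b::fd_hilbert \<Rightarrow>\<^sub>L real) \<Rightarrow> complex"
  assumes "smooth \<phi>"
  shows "partial_fourier_test \<phi> (\<zeta>, x) = fl (\<lambda>l. \<phi> (\<zeta>, blinfun_inner_right l)) x 0"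
proof -
  have meas: "(blinfun_inner_right :: 'b \<Rightarrow> _) \<in> measurable hborel borel"
    by (intro continuous_on_borel_measurable_hborel linear_continuous_on bounded_linear_blinfun_inner_right)
  have "(\<lambda>\<xi>. \<phi> (\<zeta>, \<xi>) * exp (- \<i> * of_real (blinfun_apply \<xi> x))) \<in> borel_measurable borel"
    by (intro borel_measurable_continuous_onI continuous_intros
        continuous_on_compose2[OF smooth_continuous_on[OF assms, of UNIV]]) auto
  from integral_distr[OF meas this] show ?thesis
    by (simp add: partial_fourier_test_def dual_hborel_def fl_def fl_kernel_def)
qed

text \<open>The sum is the Riesz representative of \<open>\<xi>\<close>; it carries supports in the
  dual space back to \<open>F\<close>.\<close>

lemma blinfun_eq_inner_onb_sum:
  fixes \<xi> :: "'b::fd_hilbert \<Rightarrow>\<^sub>L real"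
  shows "(\<Sum>b\<in>onb. blinfun_apply \<xi> b *\<^sub>R b) \<bullet> y = blinfun_apply \<xi> y"
proof -
  have "blinfun_apply \<xi> y = blinfun_apply \<xi> (\<Sum>b\<in>onb. (y \<bullet> b) *\<^sub>R b)"
    by (simp add: onb_expansion)
  then show ?thesis
    by (simp add: inner_sum_left blinfun.sum_right blinfun.scaleR_right inner_commute[of y] mult.commute)
qed

lemma gaussian_decay:
  assumes "0 < (c::real)"
  shows "((\<lambda>r. (1 + r) ^ n * exp (D * r - c * r\<^sup>2)) \<longlongrightarrow> 0) at_top"
  using assms by real_asymp

section \<open>The quadratic map and the CR test functions\<close>

context hermitian
begin

abbreviation Q :: "'e \<Rightarrow> 'f" where
  "Q \<equiv> hquad \<Phi>"

lemma fst_commute: "fst (\<Phi> y x) = fst (\<Phi> x y)"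
  by (subst commute) (simp add: cconj_def)

lemma Q_has_derivative: "(Q has_derivative (\<lambda>v. 2 *\<^sub>R fst (\<Phi> \<zeta> v))) (at \<zeta>)"
proof -
  have "((\<lambda>\<zeta>. fst (\<Phi> \<zeta> \<zeta>)) has_derivative (\<lambda>v. fst (\<Phi> \<zeta> v + \<Phi> v \<zeta>))) (at \<zeta>)"
    by (intro has_derivative_fst FDERIV has_derivative_ident)
  then show ?thesis
    by (simp add: hquad_def[abs_def] fst_commute[of _ \<zeta>] scaleR_2)
qed

lemma Q_add: "Q (x + y) = Q x + Q y + 2 *\<^sub>R fst (\<Phi> x y)"
  by (simp add: hquad_def add_left add_right fst_commute[of y x] scaleR_2)

lemma Q_scaleC: "Q (c *\<^sub>C x) = (cmod c)\<^sup>2 *\<^sub>R Q x"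
proof -
  have "(cmod c)\<^sup>2 = Re c * Re c + Im c * Im c"
    unfolding cmod_power2 by (simp only: power2_eq_square)
  then show ?thesis
    by (simp add: hquad_def scaleC_left scaleC_right cscale_def algebra_simps)
qed

text \<open>For fixed \<open>\<zeta>\<^sub>0\<close> this is the restriction to \<open>\<N>\<close>, embedded by \<open>(\<zeta>, x) \<mapsto> (\<zeta>, x + i \<Phi>(\<zeta>))\<close>, of a
  function holomorphic in \<open>x + i \<Phi>(\<zeta>)\<close>; hence it is CR.\<close>

definition cr_test :: "('f \<Rightarrow> complex) \<Rightarrow> 'e \<Rightarrow> 'e \<times> 'f \<Rightarrow> complex" where
  "cr_test \<psi> \<zeta>\<^sub>0 p = fl \<psi> (snd p) (Q (fst p) - Q \<zeta>\<^sub>0)"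

definition cr_test_deriv :: "('f \<Rightarrow> complex) \<Rightarrow> 'e \<Rightarrow> 'e \<times> 'f \<Rightarrow> 'e \<times> 'f \<Rightarrow> complex" where
  "cr_test_deriv \<psi> \<zeta>\<^sub>0 p w =
     fl (inner_mult (2 *\<^sub>R fst (\<Phi> (fst p) (fst w))) \<psi>) (snd p) (Q (fst p) - Q \<zeta>\<^sub>0)
     - \<i> * fl (inner_mult (snd w) \<psi>) (snd p) (Q (fst p) - Q \<zeta>\<^sub>0)"

lemma cr_test_has_derivative:
  assumes "compact A" and "test_fun A \<psi>"
  shows "(cr_test \<psi> \<zeta>\<^sub>0 has_derivative cr_test_deriv \<psi> \<zeta>\<^sub>0 p) (at p)"
proof -
  have "((\<lambda>p. (snd p, Q (fst p) - Q \<zeta>\<^sub>0)) has_derivative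
      (\<lambda>w. (snd w, 2 *\<^sub>R fst (\<Phi> (fst p) (fst w)) - 0))) (at p)"
    by (intro has_derivative_Pair has_derivative_diff has_derivative_const
        has_derivative_compose[OF _ Q_has_derivative] has_derivative_fst has_derivative_snd
        has_derivative_ident)
  from has_derivative_compose[OF this fl_has_derivative[OF assms]] show ?thesis
    by (simp add: cr_test_def[abs_def] cr_test_deriv_def[abs_def])
qed

text \<open>The value at \<open>(\<zeta>, x)\<close>, for every \<open>x\<close>, of the
  left-invariant field that equals \<open>(v, 0)\<close> at the identity.\<close>

abbreviation horizontal :: "'e \<Rightarrow> 'e \<Rightarrow> 'e \<times> 'f" where
  "horizontal \<zeta> v \<equiv> (v, 2 *\<^sub>R snd (\<Phi> \<zeta> v))"

text \<open>Antilinearity gives \<open>Re \<Phi>(\<zeta>, i v) = Im \<Phi>(\<zeta>, v)\<close> and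
  \<open>Im \<Phi>(\<zeta>, i v) = - Re \<Phi>(\<zeta>, v)\<close>, so multiplying the second
  derivative by \<open>i\<close> yields minus the first.\<close>

lemma cr_test_CR:
  assumes A: "compact A" and \<psi>: "test_fun A \<psi>"
  shows "cr_test_deriv \<psi> \<zeta>\<^sub>0 p (horizontal (fst p) v)
    + \<i> * cr_test_deriv \<psi> \<zeta>\<^sub>0 p (horizontal (fst p) (\<i> *\<^sub>C v)) = 0"
proof -
  have "\<Phi> (fst p) (\<i> *\<^sub>C v) = (snd (\<Phi> (fst p) v), - fst (\<Phi> (fst p) v))"
    by (simp add: scaleC_right cscale_def)
  moreover have "fl (inner_mult (- u) \<psi>) x y = - fl (inner_mult u \<psi>) x y" for u x y
    using linear_neg[OF linear_fl_inner_mult[OF A \<psi>]] .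
  ultimately show ?thesis
    by (simp add: cr_test_deriv_def algebra_simps)
qed

lemma CR_frechet_derivative:
  assumes g: "smooth g" and CR: "\<And>v p. Zbar \<Phi> v g p = 0"
  shows "frechet_derivative g (at p) (horizontal (fst p) v)
    + \<i> * frechet_derivative g (at p) (horizontal (fst p) (\<i> *\<^sub>C v)) = 0"
  using CR[of v p] by (simp add: Zbar_def left_field_eq[OF smooth_differentiable[OF g]])

definition pairing :: "('e \<times> 'f \<Rightarrow> complex) \<Rightarrow> ('f \<Rightarrow> complex) \<Rightarrow> 'e \<Rightarrow> 'e \<times> 'f \<Rightarrow> complex" where
  "pairing g \<psi> \<zeta>\<^sub>0 p = g p * cr_test \<psi> \<zeta>\<^sub>0 p"

definition pairing_deriv ::
  "('e \<times> 'f \<Rightarrow> complex) \<Rightarrow> ('f \<Rightarrow> complex) \<Rightarrow> 'e \<Rightarrow> 'e \<times> 'f \<Rightarrow> 'e \<times> 'f \<Rightarrow> complex" where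
  "pairing_deriv g \<psi> \<zeta>\<^sub>0 p w =
     g p * cr_test_deriv \<psi> \<zeta>\<^sub>0 p w + frechet_derivative g (at p) w * cr_test \<psi> \<zeta>\<^sub>0 p"

lemma pairing_has_derivative:
  assumes "smooth g" and "compact A" and "test_fun A \<psi>"
  shows "(pairing g \<psi> \<zeta>\<^sub>0 has_derivative pairing_deriv g \<psi> \<zeta>\<^sub>0 p) (at p)"
  unfolding pairing_def[abs_def] pairing_deriv_def[abs_def]
  using assms by (intro has_derivative_mult smooth_has_derivative cr_test_has_derivative)

text \<open>Both factors are CR, hence by the Leibniz rule so is the product; along horizontal lifts
  this says that \<open>i\<close> can be pulled out. Real linearity of the lift in \<open>v\<close>
  extends it to all \<open>c\<close>.\<close>

lemma pairing_complex_linear: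
  assumes g: "smooth g" and CR: "\<And>v p. Zbar \<Phi> v g p = 0"
    and A: "compact A" and \<psi>: "test_fun A \<psi>"
  shows "pairing_deriv g \<psi> \<zeta>\<^sub>0 p (horizontal (fst p) (c *\<^sub>C v))
    = c * pairing_deriv g \<psi> \<zeta>\<^sub>0 p (horizontal (fst p) v)"
proof -
  interpret D: bounded_linear "pairing_deriv g \<psi> \<zeta>\<^sub>0 p"
    using pairing_has_derivative[OF g A \<psi>] by (rule has_derivative_bounded_linear)
  let ?h = "horizontal (fst p)"
  let ?a = "cr_test_deriv \<psi> \<zeta>\<^sub>0 p" and ?b = "frechet_derivative g (at p)"
  have "pairing_deriv g \<psi> \<zeta>\<^sub>0 p (?h v) + \<i> * pairing_deriv g \<psi> \<zeta>\<^sub>0 p (?h (\<i> *\<^sub>C v))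
      = g p * (?a (?h v) + \<i> * ?a (?h (\<i> *\<^sub>C v)))
        + (?b (?h v) + \<i> * ?b (?h (\<i> *\<^sub>C v))) * cr_test \<psi> \<zeta>\<^sub>0 p"
    unfolding pairing_deriv_def by algebra
  then have "pairing_deriv g \<psi> \<zeta>\<^sub>0 p (?h v) + \<i> * pairing_deriv g \<psi> \<zeta>\<^sub>0 p (?h (\<i> *\<^sub>C v)) = 0"
    by (simp only: cr_test_CR[OF A \<psi>] CR_frechet_derivative[OF g CR]) simp
  then have i: "pairing_deriv g \<psi> \<zeta>\<^sub>0 p (?h (\<i> *\<^sub>C v)) = \<i> * pairing_deriv g \<psi> \<zeta>\<^sub>0 p (?h v)"
    by (simp add: complex_eq_iff)
  have "c *\<^sub>C v = Re c *\<^sub>R v + Im c *\<^sub>R (\<i> *\<^sub>C v)"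
    by (simp add: scaleR_scaleC scaleC_scaleC scaleC_add_left[symmetric] mult.commute
        complex_eq[symmetric])
  then have "?h (c *\<^sub>C v) = Re c *\<^sub>R ?h v + Im c *\<^sub>R ?h (\<i> *\<^sub>C v)"
    by (simp add: add_right scaleR_right scaleR_add_right mult.commute)
  then have "pairing_deriv g \<psi> \<zeta>\<^sub>0 p (?h (c *\<^sub>C v))
      = Re c *\<^sub>R pairing_deriv g \<psi> \<zeta>\<^sub>0 p (?h v) + Im c *\<^sub>R (\<i> * pairing_deriv g \<psi> \<zeta>\<^sub>0 p (?h v))"
    by (simp only: D.add D.scaleR i)
  also have "\<dots> = c * pairing_deriv g \<psi> \<zeta>\<^sub>0 p (?h v)"
    by (simp add: complex_eq_iff)
  finally show ?thesis .
qed

section \<open>Growth estimates for the pairing and its derivative\<close>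

lemma one_plus_norm_Q_diff_le:
  obtains B where "1 \<le> B" and "\<And>\<zeta>. 1 + norm (Q \<zeta> - Q \<zeta>\<^sub>0) \<le> B * (1 + norm \<zeta>)\<^sup>2"
proof -
  obtain K where K: "0 < K" "\<And>x y. norm (\<Phi> x y) \<le> norm x * norm y * K"
    using pos_bounded by blast
  have "1 + norm (Q \<zeta> - Q \<zeta>\<^sub>0) \<le> (1 + norm (Q \<zeta>\<^sub>0) + K) * (1 + norm \<zeta>)\<^sup>2" for \<zeta>
  proof -
    have "norm (Q \<zeta>) \<le> K * (norm \<zeta>)\<^sup>2"
      using order_trans[OF norm_fst_le_norm K(2)[of \<zeta> \<zeta>]] by (simp add: hquad_def power2_eq_square mult_ac)
    then have "1 + norm (Q \<zeta> - Q \<zeta>\<^sub>0) \<le> (1 + norm (Q \<zeta>\<^sub>0)) * 1 + K * (norm \<zeta>)\<^sup>2"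
      using norm_triangle_ineq4[of "Q \<zeta>" "Q \<zeta>\<^sub>0"] by simp
    also have "\<dots> \<le> (1 + norm (Q \<zeta>\<^sub>0)) * (1 + norm \<zeta>)\<^sup>2 + K * (1 + norm \<zeta>)\<^sup>2"
      using K(1) by (intro add_mono mult_left_mono power_mono one_le_power) auto
    finally show ?thesis
      by (simp add: algebra_simps)
  qed
  then show thesis
    using that[of "1 + norm (Q \<zeta>\<^sub>0) + K"] K(1) by simp
qed

lemma cr_test_deriv_bound:
  assumes A: "compact A" and \<psi>: "test_fun A \<psi>"
  obtains C where "0 \<le> C" and "\<And>p M w. \<forall>l\<in>A. l \<bullet> (Q (fst p) - Q \<zeta>\<^sub>0) \<le> M \<Longrightarrow>
    (1 + l1norm (snd p)) ^ N * norm (cr_test_deriv \<psi> \<zeta>\<^sub>0 p w)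
      \<le> C * (1 + norm (Q (fst p) - Q \<zeta>\<^sub>0)) ^ N * exp M * ((1 + norm (fst p)) * norm w)"
proof -
  obtain K where K: "0 < K" "\<And>x y. norm (\<Phi> x y) \<le> norm x * norm y * K"
    using pos_bounded by blast
  obtain C where C: "0 \<le> C" "\<And>x y M u. \<forall>l\<in>A. l \<bullet> y \<le> M \<Longrightarrow>
      (1 + l1norm x) ^ N * norm (fl (inner_mult u \<psi>) x y) \<le> C * (1 + norm y) ^ N * exp M * norm u"
    using fl_inner_mult_decay[OF A \<psi>] by blast
  show thesis
  proof
    show "0 \<le> C * (2 * K + 1)"
      using C(1) K(1) by simp
    fix p :: "'e \<times> 'f" and M and w :: "'e \<times> 'f"
    let ?y = "Q (fst p) - Q \<zeta>\<^sub>0" and ?a = "2 *\<^sub>R fst (\<Phi> (fst p) (fst w))"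
    let ?P = "(1 + l1norm (snd p)) ^ N" and ?E = "C * (1 + norm (Q (fst p) - Q \<zeta>\<^sub>0)) ^ N * exp M"
    assume M: "\<forall>l\<in>A. l \<bullet> ?y \<le> M"
    have E: "0 \<le> ?E"
      using C(1) by simp
    have "norm ?a \<le> 2 * (norm (fst p) * norm (fst w) * K)"
      using order_trans[OF norm_fst_le_norm K(2)[of "fst p" "fst w"]] by simp
    also have "\<dots> \<le> 2 * (norm (fst p) * norm w * K)"
      using K(1) norm_fst_le_norm[of w] by (intro mult_left_mono mult_right_mono) auto
    finally have "norm ?a + norm (snd w)
        \<le> 2 * (norm (fst p) * norm w * K) + norm w + (2 * K * norm w + norm (fst p) * norm w)"
      using norm_snd_le_norm[of w] K(1) by (intro add_increasing2 add_mono) auto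
    also have "\<dots> = (2 * K + 1) * ((1 + norm (fst p)) * norm w)"
      by algebra
    finally have "norm ?a + norm (snd w) \<le> \<dots>" .
    note sum_le = mult_left_mono[OF this E]
    have "?P * norm (cr_test_deriv \<psi> \<zeta>\<^sub>0 p w)
        \<le> ?P * (norm (fl (inner_mult ?a \<psi>) (snd p) ?y) + norm (fl (inner_mult (snd w) \<psi>) (snd p) ?y))"
      unfolding cr_test_deriv_def
      by (intro mult_left_mono order_trans[OF norm_triangle_ineq4]) (simp_all add: norm_mult)
    also have "\<dots> = ?P * norm (fl (inner_mult ?a \<psi>) (snd p) ?y)
        + ?P * norm (fl (inner_mult (snd w) \<psi>) (snd p) ?y)"
      by (rule distrib_left)
    also have "\<dots> \<le> ?E * norm ?a + ?E * norm (snd w)"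
      by (intro add_mono C(2) M)
    also have "\<dots> = ?E * (norm ?a + norm (snd w))"
      by (rule distrib_left[symmetric])
    also note sum_le
    finally show "?P * norm (cr_test_deriv \<psi> \<zeta>\<^sub>0 p w)
        \<le> C * (2 * K + 1) * (1 + norm ?y) ^ N * exp M * ((1 + norm (fst p)) * norm w)"
      by (simp only: mult_ac)
  qed
qed

text \<open>\<open>g\<close> and its derivative grow at most like the power \<open>k\<close> of
  \<open>1 + norm p\<close>, while the transform decays to any order: asking for order
  \<open>k + m\<close> leaves \<open>m\<close> powers in \<open>x\<close>. In \<open>fst p\<close>
  the bound stays polynomial, to be beaten later by \<open>exp M\<close>.\<close>

lemma pairing_growth:
  assumes g: "g \<in> O_space \<Phi> K" and A: "compact A" and \<psi>: "test_fun A \<psi>"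
  obtains C n where "0 \<le> C"
    and "\<And>p M. \<forall>l\<in>A. l \<bullet> (Q (fst p) - Q \<zeta>\<^sub>0) \<le> M \<Longrightarrow>
      norm (pairing g \<psi> \<zeta>\<^sub>0 p) \<le> C * (1 + norm (fst p)) ^ n * exp M / (1 + l1norm (snd p)) ^ m"
    and "\<And>p M w. \<forall>l\<in>A. l \<bullet> (Q (fst p) - Q \<zeta>\<^sub>0) \<le> M \<Longrightarrow>
      norm (pairing_deriv g \<psi> \<zeta>\<^sub>0 p w)
        \<le> C * (1 + norm (fst p)) ^ n * exp M / (1 + l1norm (snd p)) ^ m * norm w"
proof -
  obtain G k where G: "0 \<le> G" "\<And>p. norm (g p) \<le> G * (1 + norm p) ^ k"
      "\<And>p w. norm (frechet_derivative g (at p) w) \<le> G * (1 + norm p) ^ k * norm w"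
    using O_space_growth[OF g] by blast
  obtain B where B: "1 \<le> B" "\<And>\<zeta>. 1 + norm (Q \<zeta> - Q \<zeta>\<^sub>0) \<le> B * (1 + norm \<zeta>)\<^sup>2"
    using one_plus_norm_Q_diff_le by blast
  obtain C1 where C1: "0 \<le> C1" "\<And>x y M. \<forall>l\<in>A. l \<bullet> y \<le> M \<Longrightarrow>
      (1 + l1norm x) ^ (k + m) * norm (fl \<psi> x y) \<le> C1 * (1 + norm y) ^ (k + m) * exp M"
    using fl_decay[OF A \<psi>] by blast
  obtain C2 where C2: "0 \<le> C2" "\<And>p M w. \<forall>l\<in>A. l \<bullet> (Q (fst p) - Q \<zeta>\<^sub>0) \<le> M \<Longrightarrow>
      (1 + l1norm (snd p)) ^ (k + m) * norm (cr_test_deriv \<psi> \<zeta>\<^sub>0 p w)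
        \<le> C2 * (1 + norm (Q (fst p) - Q \<zeta>\<^sub>0)) ^ (k + m) * exp M * ((1 + norm (fst p)) * norm w)"
    using cr_test_deriv_bound[OF A \<psi>, where \<zeta>\<^sub>0 = \<zeta>\<^sub>0] by blast
  define C where "C = G * (B ^ (k + m) * (C1 + C2))"
  \<comment> \<open>\<open>k\<close> powers come from \<open>g\<close>, \<open>2 * (k + m)\<close>
    are the price of the decay, as \<open>Q\<close> is quadratic, and the last one comes from the
    derivative of \<open>Q\<close>.\<close>
  define n where "n = k + (2 * (k + m) + 1)"
  define U where "U M p = B ^ (k + m) * (1 + norm (fst p)) ^ (2 * (k + m)) * exp M / (1 + l1norm (snd p)) ^ (k + m)"
    for M and p :: "'e \<times> 'f"
  define V where "V p = (1 + norm (fst p)) ^ k * (1 + l1norm (snd p)) ^ k" for p :: "'e \<times> 'f"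
  have pos: "0 < 1 + l1norm x" for x :: 'f
    using l1norm_nonneg[of x] by linarith
  have U: "0 \<le> U M p" and V: "0 \<le> V p" for M p
    using B(1) by (simp_all add: U_def V_def)
  have y: "(1 + norm (Q (fst p) - Q \<zeta>\<^sub>0)) ^ (k + m) * exp M / (1 + l1norm (snd p)) ^ (k + m) \<le> U M p" for p M
  proof -
    have "(1 + norm (Q (fst p) - Q \<zeta>\<^sub>0)) ^ (k + m) \<le> (B * (1 + norm (fst p))\<^sup>2) ^ (k + m)"
      using B(2) by (intro power_mono) auto
    also have "\<dots> = B ^ (k + m) * (1 + norm (fst p)) ^ (2 * (k + m))"
      by (simp only: power_mult_distrib power_mult)
    finally show ?thesis
      unfolding U_def using pos[of "snd p"] by (intro divide_right_mono mult_right_mono) auto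
  qed
  have p: "(1 + norm p) ^ k \<le> V p" for p :: "'e \<times> 'f"
  proof -
    have "norm p \<le> norm (fst p) + norm (snd p)"
      using norm_Pair_le[of "fst p" "snd p"] by simp
    also have "\<dots> \<le> norm (fst p) + l1norm (snd p)"
      using norm_le_l1norm by simp
    finally have "norm p \<le> norm (fst p) + l1norm (snd p)" .
    moreover have "0 \<le> norm (fst p) * l1norm (snd p)"
      by simp
    ultimately have "1 + norm p \<le> (1 + norm (fst p)) * (1 + l1norm (snd p))"
      unfolding distrib_left distrib_right by linarith
    then have "(1 + norm p) ^ k \<le> ((1 + norm (fst p)) * (1 + l1norm (snd p))) ^ k"
      by (intro power_mono) auto
    then show ?thesis
      by (simp add: V_def power_mult_distrib)
  qed
  have cr: "norm (cr_test \<psi> \<zeta>\<^sub>0 p) \<le> C1 * U M p" if M: "\<forall>l\<in>A. l \<bullet> (Q (fst p) - Q \<zeta>\<^sub>0) \<le> M" for p M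
  proof -
    have "norm (cr_test \<psi> \<zeta>\<^sub>0 p)
        \<le> C1 * ((1 + norm (Q (fst p) - Q \<zeta>\<^sub>0)) ^ (k + m) * exp M / (1 + l1norm (snd p)) ^ (k + m))"
      using C1(2)[OF M, of "snd p"] pos[of "snd p"]
      by (simp add: cr_test_def pos_le_divide_eq mult_ac)
    also note mult_left_mono[OF y C1(1)]
    finally show ?thesis .
  qed
  have cr': "norm (cr_test_deriv \<psi> \<zeta>\<^sub>0 p w) \<le> C2 * U M p * ((1 + norm (fst p)) * norm w)"
    if M: "\<forall>l\<in>A. l \<bullet> (Q (fst p) - Q \<zeta>\<^sub>0) \<le> M" for p M w
  proof -
    have "norm (cr_test_deriv \<psi> \<zeta>\<^sub>0 p w)
        \<le> C2 * ((1 + norm (Q (fst p) - Q \<zeta>\<^sub>0)) ^ (k + m) * exp M / (1 + l1norm (snd p)) ^ (k + m))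
          * ((1 + norm (fst p)) * norm w)"
      using C2(2)[OF M, of w] pos[of "snd p"]
      by (simp add: pos_le_divide_eq mult_ac)
    also have "\<dots> \<le> C2 * U M p * ((1 + norm (fst p)) * norm w)"
      by (intro mult_right_mono mult_left_mono[OF y C2(1)]) auto
    finally show ?thesis .
  qed
  \<comment> \<open>The \<open>k\<close> powers of \<open>1 + l1norm (snd p)\<close> in
    \<open>V\<close> cancel against \<open>U\<close>, which leaves the exponent
    \<open>m\<close>.\<close>
  have UV: "G * V p * ((C1 + C2) * U M p * (1 + norm (fst p)))
      = C * (1 + norm (fst p)) ^ n * exp M / (1 + l1norm (snd p)) ^ m" for p M
  proof -
    have "V p * U M p * (1 + norm (fst p))
        = B ^ (k + m) * (1 + norm (fst p)) ^ n * exp M / (1 + l1norm (snd p)) ^ m"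
    proof -
      have "zk * rk * (b * a * e / (rk * rm)) * z = b * (zk * (a * z)) * e / rm" if "rk \<noteq> 0"
        for zk rk b a e rm z :: real
        using that by simp
      then show ?thesis
        unfolding U_def V_def n_def power_add[of _ k] power_add[of _ "2 * (k + m)"] power_one_right
        using pos[of "snd p"] by (metis less_irrefl zero_less_power)
    qed
    then show ?thesis
      by (simp add: C_def mult_ac)
  qed
  show thesis
  proof
    show "0 \<le> C"
      using G(1) B(1) C1(1) C2(1) by (simp add: C_def)
    fix p :: "'e \<times> 'f" and M
    assume M: "\<forall>l\<in>A. l \<bullet> (Q (fst p) - Q \<zeta>\<^sub>0) \<le> M"
    let ?z = "1 + norm (fst p)"
    have GV: "norm (g p) \<le> G * V p"
      using order_trans[OF G(2) mult_left_mono[OF p G(1)]] .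
    have cz: "C1 * U M p \<le> C1 * U M p * ?z"
      using C1(1) U[of M p] by (simp add: algebra_simps)
    have "norm (pairing g \<psi> \<zeta>\<^sub>0 p) \<le> G * V p * (C1 * U M p)"
      unfolding pairing_def norm_mult using G(1) V by (intro mult_mono GV cr[OF M]) auto
    also have "\<dots> \<le> G * V p * ((C1 + C2) * U M p * ?z)"
      using cz C2(1) U[of M p] G(1) V[of p] by (intro mult_left_mono) (auto simp: algebra_simps intro: add_increasing2)
    finally show "norm (pairing g \<psi> \<zeta>\<^sub>0 p)
        \<le> C * ?z ^ n * exp M / (1 + l1norm (snd p)) ^ m"
      by (simp only: UV)
    fix w :: "'e \<times> 'f"
    have "norm (frechet_derivative g (at p) w) \<le> G * V p * norm w"
      using order_trans[OF G(3) mult_right_mono[OF mult_left_mono[OF p G(1)] norm_ge_zero]] .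
    then have "norm (frechet_derivative g (at p) w) * norm (cr_test \<psi> \<zeta>\<^sub>0 p)
        \<le> G * V p * norm w * (C1 * U M p * ?z)"
      using G(1) V by (intro mult_mono order_trans[OF cr[OF M] cz]) auto
    moreover have "norm (g p) * norm (cr_test_deriv \<psi> \<zeta>\<^sub>0 p w) \<le> G * V p * (C2 * U M p * (?z * norm w))"
      using G(1) V by (intro mult_mono GV cr'[OF M]) auto
    ultimately have "norm (pairing_deriv g \<psi> \<zeta>\<^sub>0 p w)
        \<le> G * V p * (C2 * U M p * (?z * norm w)) + G * V p * norm w * (C1 * U M p * ?z)"
      unfolding pairing_deriv_def
      by (intro order_trans[OF norm_triangle_ineq]) (simp only: norm_mult add_mono)
    also have "\<dots> = G * V p * ((C1 + C2) * U M p * ?z) * norm w"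
      by algebra
    finally show "norm (pairing_deriv g \<psi> \<zeta>\<^sub>0 p w)
        \<le> C * ?z ^ n * exp M / (1 + l1norm (snd p)) ^ m * norm w"
      by (simp only: UV)
  qed
qed

section \<open>Dependence of the integral on the complex parameter\<close>

lemma compact_inner_Q_bounded:
  assumes "compact A"
  obtains M where "\<And>\<zeta> l. l \<in> A \<Longrightarrow> norm \<zeta> \<le> R \<Longrightarrow> l \<bullet> (Q \<zeta> - Q \<zeta>\<^sub>0) \<le> M"
proof -
  obtain a where a: "0 < a" "\<And>l. l \<in> A \<Longrightarrow> norm l \<le> a"
    using compact_imp_bounded[OF assms] by (auto simp: bounded_pos)
  obtain B where B: "1 \<le> B" "\<And>\<zeta>. 1 + norm (Q \<zeta> - Q \<zeta>\<^sub>0) \<le> B * (1 + norm \<zeta>)\<^sup>2"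
    using one_plus_norm_Q_diff_le by blast
  show thesis
  proof
    fix \<zeta> :: 'e and l
    assume l: "l \<in> A" and \<zeta>: "norm \<zeta> \<le> R"
    have "norm (Q \<zeta> - Q \<zeta>\<^sub>0) \<le> B * (1 + norm \<zeta>)\<^sup>2"
      using B(2)[of \<zeta>] by linarith
    also have "\<dots> \<le> B * (1 + R)\<^sup>2"
      using B(1) \<zeta> by (intro mult_left_mono power_mono) auto
    finally have "norm (Q \<zeta> - Q \<zeta>\<^sub>0) \<le> B * (1 + R)\<^sup>2" .
    then show "l \<bullet> (Q \<zeta> - Q \<zeta>\<^sub>0) \<le> a * (B * (1 + R)\<^sup>2)"
      using a l by (intro order_trans[OF norm_cauchy_schwarz] mult_mono) auto
  qed
qed

lemma pairing_integral_has_field_derivative: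
  assumes g: "g \<in> O_space \<Phi> K" and A: "compact A" and \<psi>: "test_fun A \<psi>"
  shows "\<exists>D. ((\<lambda>z. \<integral>x. pairing g \<psi> \<zeta>\<^sub>0 (\<zeta>\<^sub>0 + z *\<^sub>C v, x) \<partial>hborel) has_field_derivative D) (at z)"
proof -
  have smooth: "smooth g" and CR: "\<And>v p. Zbar \<Phi> v g p = 0"
    using g unfolding O_space_def by blast+
  note k_deriv = pairing_has_derivative[OF smooth A \<psi>, where \<zeta>\<^sub>0 = \<zeta>\<^sub>0]
  let ?k = "pairing g \<psi> \<zeta>\<^sub>0" and ?k' = "pairing_deriv g \<psi> \<zeta>\<^sub>0"
  let ?m = "2 * card (onb :: 'f set)"
  define \<zeta> where "\<zeta> = \<zeta>\<^sub>0 + z *\<^sub>C v"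
  \<comment> \<open>\<open>(\<zeta>, x) + T h\<close> is the group product of
    \<open>(\<zeta>, x)\<close> with \<open>(h *\<^sub>C v, 0)\<close>.\<close>
  define T where "T h = horizontal \<zeta> (h *\<^sub>C v)" for h
  have T: "bounded_linear T"
    unfolding T_def
    by (intro bounded_linear_Pair bounded_linear_scaleC_left
        bounded_linear_compose[OF bounded_linear_scaleR_right]
        bounded_linear_compose[OF bounded_linear_snd]
        bounded_linear_compose[OF bounded_linear_right])
  then obtain S where S: "0 \<le> S" "\<And>h. norm (T h) \<le> norm h * S"
    using bounded_linear.nonneg_bounded by blast
  \<comment> \<open>For \<open>norm h < 1\<close>, \<open>s\<close> bounds \<open>1 + l1norm\<close>
    of the vertical displacement and \<open>R\<close> the norm of the first component; so the
    dominating function \<open>W\<close> does not depend on \<open>h\<close>.\<close>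
  define s where "s = 1 + real (card (onb :: 'f set)) * S"
  define R where "R = norm \<zeta> + S"
  obtain C n where C: "0 \<le> C"
    "\<And>p M. \<forall>l\<in>A. l \<bullet> (Q (fst p) - Q \<zeta>\<^sub>0) \<le> M \<Longrightarrow>
      norm (?k p) \<le> C * (1 + norm (fst p)) ^ n * exp M / (1 + l1norm (snd p)) ^ ?m"
    "\<And>p M w. \<forall>l\<in>A. l \<bullet> (Q (fst p) - Q \<zeta>\<^sub>0) \<le> M \<Longrightarrow>
      norm (?k' p w) \<le> C * (1 + norm (fst p)) ^ n * exp M / (1 + l1norm (snd p)) ^ ?m * norm w"
    using pairing_growth[OF g A \<psi>, where m = ?m and \<zeta>\<^sub>0 = \<zeta>\<^sub>0] by blast
  obtain M where M: "\<And>\<zeta> l. l \<in> A \<Longrightarrow> norm \<zeta> \<le> R \<Longrightarrow> l \<bullet> (Q \<zeta> - Q \<zeta>\<^sub>0) \<le> M"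
    using compact_inner_Q_bounded[OF A] by blast
  have pos: "0 < 1 + l1norm x" for x :: 'f
    using l1norm_nonneg[of x] by linarith
  define W where "W x = C * (1 + R) ^ n * exp M * s ^ ?m * (1 / (1 + l1norm x) ^ ?m)" for x :: 'f
  have W: "integrable hborel W"
    unfolding W_def[abs_def] by (intro integrable_mult_right integrable_l1norm_power)
  have k_cont: "continuous_on UNIV (\<lambda>x. ?k (\<zeta>' + 0, x + u))" for \<zeta>' u
  proof -
    have "continuous_on UNIV ?k"
      using has_derivative_continuous[OF k_deriv] by (simp add: continuous_at_imp_continuous_on)
    then show ?thesis
      by (rule continuous_on_compose2) (auto intro!: continuous_intros)
  qed
  have bounds: "norm (?k ((\<zeta>, x) + T h)) \<le> W x" "norm (?k' ((\<zeta>, x) + T h) w) \<le> W x * norm w"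
    if h: "h \<in> ball 0 1" for x h w
  proof -
    let ?p = "(\<zeta>, x) + T h"
    have Th: "norm (T h) \<le> S"
      using S(2)[of h] S(1) h mult_right_mono[of "norm h" 1 S] by simp
    then have fst_p: "norm (fst ?p) \<le> R"
      using norm_triangle_ineq[of \<zeta> "fst (T h)"] norm_fst_le_norm[of "T h"] by (simp add: R_def)
    have "l1norm (snd (T h)) \<le> real (card (onb :: 'f set)) * S"
      using Th norm_snd_le_norm[of "T h"] by (intro order_trans[OF l1norm_le_norm] mult_left_mono) auto
    then have "1 + l1norm x \<le> (1 + l1norm (snd ?p)) * s"
      unfolding s_def snd_add snd_conv using pos[of "x + snd (T h)"]
      by (intro order_trans[OF one_plus_l1norm_translate[of x "snd (T h)"]] mult_left_mono) auto
    then have "(1 + l1norm x) ^ ?m \<le> ((1 + l1norm (snd ?p)) * s) ^ ?m"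
      using pos[of x] by (intro power_mono) auto
    then have le1: "1 / (1 + l1norm (snd ?p)) ^ ?m \<le> s ^ ?m * (1 / (1 + l1norm x) ^ ?m)"
      using zero_less_power[OF pos[of "snd ?p"], of ?m] zero_less_power[OF pos[of x], of ?m]
      by (simp only: power_mult_distrib) (simp add: field_simps)
    have le2: "C * (1 + norm (fst ?p)) ^ n * exp M \<le> C * (1 + R) ^ n * exp M"
      using C(1) fst_p by (intro mult_right_mono mult_left_mono power_mono) auto
    have le: "C * (1 + norm (fst ?p)) ^ n * exp M * (1 / (1 + l1norm (snd ?p)) ^ ?m)
        \<le> C * (1 + R) ^ n * exp M * (s ^ ?m * (1 / (1 + l1norm x) ^ ?m))"
      by (rule mult_mono[OF le2 le1]) (use C(1) S(1) pos[of "snd ?p"] in \<open>auto simp: R_def\<close>)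
    have M': "\<forall>l\<in>A. l \<bullet> (Q (fst ?p) - Q \<zeta>\<^sub>0) \<le> M"
      using M fst_p by blast
    have W_le: "C * (1 + norm (fst ?p)) ^ n * exp M / (1 + l1norm (snd ?p)) ^ ?m \<le> W x"
      using le by (simp add: W_def mult.assoc)
    show "norm (?k ?p) \<le> W x"
      using C(2)[OF M'] W_le by (rule order_trans)
    show "norm (?k' ?p w) \<le> W x * norm w"
      using C(3)[OF M'] mult_right_mono[OF W_le norm_ge_zero] by (rule order_trans)
  qed
  have "((\<lambda>h. \<integral>x. ?k ((\<zeta>, x) + T h) \<partial>hborel) has_derivative
      (\<lambda>h. \<integral>x. ?k' ((\<zeta>, x) + T 0) (T h) \<partial>hborel)) (at 0)"
  proof (rule has_derivative_integral_dominated[of 1 _ _ _ "\<lambda>h x e. ?k' ((\<zeta>, x) + T h) (T e)"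
        "\<lambda>x. W x * S"])
    fix h :: complex
    assume h: "h \<in> ball 0 1"
    show "integrable hborel (\<lambda>x. ?k ((\<zeta>, x) + T h))"
    proof (rule Bochner_Integration.integrable_bound[OF W])
      show "(\<lambda>x. ?k ((\<zeta>, x) + T h)) \<in> borel_measurable hborel"
        using k_cont[of "\<zeta> + fst (T h)" "snd (T h)"]
        by (intro continuous_on_borel_measurable_hborel) (simp add: plus_prod_def)
      show "AE x in hborel. norm (?k ((\<zeta>, x) + T h)) \<le> norm (W x)"
        using bounds(1)[OF h] by (auto intro: order_trans[OF _ abs_ge_self])
    qed
    fix x e
    have "((\<lambda>h. (\<zeta>, x) + T h) has_derivative (\<lambda>e. 0 + T e)) (at h)"
      by (intro has_derivative_add has_derivative_const bounded_linear_imp_has_derivative T)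
    then have "((\<lambda>h. (\<zeta>, x) + T h) has_derivative T) (at h)"
      by simp
    from has_derivative_compose[OF this k_deriv]
    show "((\<lambda>h. ?k ((\<zeta>, x) + T h)) has_derivative (\<lambda>e. ?k' ((\<zeta>, x) + T h) (T e))) (at h)" .
    have W0: "0 \<le> W x"
      using order_trans[OF norm_ge_zero bounds(1)[OF h]] .
    show "norm (?k' ((\<zeta>, x) + T h) (T e)) \<le> W x * S * norm e"
      using order_trans[OF bounds(2)[OF h] mult_left_mono[OF S(2) W0], of "e"] by (simp add: mult_ac)
  qed (use W in auto)
  \<comment> \<open>The vertical displacement is constant in \<open>x\<close>, so translation
    invariance removes it: only the motion of \<open>\<zeta>\<close> remains.\<close>
  moreover have "(\<integral>x. ?k ((\<zeta>, x) + T h) \<partial>hborel) = (\<integral>x. ?k (\<zeta>\<^sub>0 + (h + z) *\<^sub>C v, x) \<partial>hborel)" for h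
    using hborel_translate_continuous[OF k_cont[of "\<zeta>\<^sub>0 + (h + z) *\<^sub>C v" 0], of "2 *\<^sub>R snd (\<Phi> \<zeta> (h *\<^sub>C v))"]
    by (simp add: T_def \<zeta>_def scaleC_add_left add_ac)
  \<comment> \<open>Here the CR equation enters: the real derivative in \<open>h\<close> is
    multiplication by one complex number.\<close>
  moreover have "?k' ((\<zeta>, x) + T 0) (T h) = h * ?k' (\<zeta>, x) (T 1)" for h x
    using pairing_complex_linear[OF smooth CR A \<psi>, of \<zeta>\<^sub>0 "(\<zeta>, x)" h v]
      pairing_complex_linear[OF smooth CR A \<psi>, of \<zeta>\<^sub>0 "(\<zeta>, x)" 1 v]
      linear_0[OF bounded_linear.linear[OF T]]
    by (simp add: T_def)
  ultimately have "((\<lambda>h. \<integral>x. ?k (\<zeta>\<^sub>0 + (h + z) *\<^sub>C v, x) \<partial>hborel) has_field_derivative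
      (\<integral>x. ?k' (\<zeta>, x) (T 1) \<partial>hborel)) (at 0)"
    by (simp add: has_field_derivative_def mult_commute_abs)
  then show ?thesis
    using DERIV_shift[of "\<lambda>z. \<integral>x. ?k (\<zeta>\<^sub>0 + z *\<^sub>C v, x) \<partial>hborel" _ 0 z] by auto
qed

lemma pairing_integral_tendsto_0:
  assumes g: "g \<in> O_space \<Phi> K" and A: "compact A" and \<psi>: "test_fun A \<psi>"
    and neg: "\<And>l. l \<in> A \<Longrightarrow> l \<bullet> Q v < 0"
  shows "((\<lambda>z. \<integral>x. pairing g \<psi> \<zeta>\<^sub>0 (\<zeta>\<^sub>0 + z *\<^sub>C v, x) \<partial>hborel) \<longlongrightarrow> 0) at_infinity"
proof -
  let ?m = "2 * card (onb :: 'f set)"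
  \<comment> \<open>Compactness of \<open>A\<close> turns the pointwise inequality into a uniform
    gap \<open>c\<close>; for empty \<open>A\<close> any positive value serves.\<close>
  obtain c where c: "0 < c" "\<And>l. l \<in> A \<Longrightarrow> l \<bullet> Q v \<le> - c"
  proof (cases "A = {}")
    case False
    have "continuous_on A (\<lambda>l. l \<bullet> Q v)"
      by (intro continuous_intros)
    from continuous_attains_sup[OF A False this]
    obtain l where "l \<in> A" "\<And>l'. l' \<in> A \<Longrightarrow> l' \<bullet> Q v \<le> l \<bullet> Q v"
      by blast
    then show thesis
      using neg[of l] by (intro that[of "- (l \<bullet> Q v)"]) auto
  qed (use that[of 1] in auto)
  obtain a where a: "0 < a" "\<And>l. l \<in> A \<Longrightarrow> norm l \<le> a"
    using compact_imp_bounded[OF A] by (auto simp: bounded_pos)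
  have lin: "bounded_linear (\<lambda>z. 2 *\<^sub>R fst (\<Phi> \<zeta>\<^sub>0 (z *\<^sub>C v)))"
    by (intro bounded_linear_compose[OF bounded_linear_scaleR_right]
        bounded_linear_compose[OF bounded_linear_fst]
        bounded_linear_compose[OF bounded_linear_right] bounded_linear_scaleC_left)
  then obtain L where L: "0 \<le> L" "\<And>z. norm (2 *\<^sub>R fst (\<Phi> \<zeta>\<^sub>0 (z *\<^sub>C v))) \<le> norm z * L"
    using bounded_linear.nonneg_bounded by blast
  obtain J where J: "0 \<le> J" "\<And>z. norm (z *\<^sub>C v) \<le> norm z * J"
    using bounded_linear.nonneg_bounded[OF bounded_linear_scaleC_left] by blast
  obtain C n where C: "0 \<le> C" "\<And>p M. \<forall>l\<in>A. l \<bullet> (Q (fst p) - Q \<zeta>\<^sub>0) \<le> M \<Longrightarrow>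
      norm (pairing g \<psi> \<zeta>\<^sub>0 p) \<le> C * (1 + norm (fst p)) ^ n * exp M / (1 + l1norm (snd p)) ^ ?m"
    by (rule pairing_growth[OF g A \<psi>, where m = ?m and \<zeta>\<^sub>0 = \<zeta>\<^sub>0]) (rule that)
  define b where "b = 1 + norm \<zeta>\<^sub>0 + J"
  define I where "I = (\<integral>x. 1 / (1 + l1norm (x :: 'f)) ^ ?m \<partial>hborel)"
  have I: "0 \<le> I"
    unfolding I_def by (intro integral_nonneg_AE) auto
  have bound: "norm (\<integral>x. pairing g \<psi> \<zeta>\<^sub>0 (\<zeta>\<^sub>0 + z *\<^sub>C v, x) \<partial>hborel)
      \<le> C * b ^ n * I * ((1 + norm z) ^ n * exp (a * L * norm z - c * (norm z)\<^sup>2))" for z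
  proof -
    \<comment> \<open>In the expansion of \<open>Q (\<zeta>\<^sub>0 + z *\<^sub>C v)\<close> the
      quadratic part \<open>(cmod z)\<^sup>2 *\<^sub>R Q v\<close> contributes at most
      \<open>- c * (norm z)\<^sup>2\<close>, and the cross term at most
      \<open>a * L * norm z\<close>.\<close>
    let ?M = "a * L * norm z - c * (norm z)\<^sup>2"
    have M: "\<forall>l\<in>A. l \<bullet> (Q (\<zeta>\<^sub>0 + z *\<^sub>C v) - Q \<zeta>\<^sub>0) \<le> ?M"
    proof
      fix l
      assume l: "l \<in> A"
      have "l \<bullet> (Q (\<zeta>\<^sub>0 + z *\<^sub>C v) - Q \<zeta>\<^sub>0)
          = (cmod z)\<^sup>2 * (l \<bullet> Q v) + l \<bullet> (2 *\<^sub>R fst (\<Phi> \<zeta>\<^sub>0 (z *\<^sub>C v)))"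
        by (simp add: Q_add Q_scaleC inner_add_right)
      also have "\<dots> \<le> (cmod z)\<^sup>2 * (- c) + a * (norm z * L)"
      proof (rule add_mono)
        show "(cmod z)\<^sup>2 * (l \<bullet> Q v) \<le> (cmod z)\<^sup>2 * (- c)"
          using c(2)[OF l] by (intro mult_left_mono) auto
        show "l \<bullet> (2 *\<^sub>R fst (\<Phi> \<zeta>\<^sub>0 (z *\<^sub>C v))) \<le> a * (norm z * L)"
          using a(1) by (intro order_trans[OF norm_cauchy_schwarz] mult_mono a(2)[OF l] L(2)) auto
      qed
      finally show "l \<bullet> (Q (\<zeta>\<^sub>0 + z *\<^sub>C v) - Q \<zeta>\<^sub>0) \<le> ?M"
        by (simp add: mult_ac)
    qed
    let ?P = "C * (1 + norm (\<zeta>\<^sub>0 + z *\<^sub>C v)) ^ n * exp ?M"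
    have "norm (\<integral>x. pairing g \<psi> \<zeta>\<^sub>0 (\<zeta>\<^sub>0 + z *\<^sub>C v, x) \<partial>hborel)
        \<le> (\<integral>x. ?P * (1 / (1 + l1norm (x :: 'f)) ^ ?m) \<partial>hborel)"
    proof (rule order_trans[OF integral_norm_bound integral_mono'])
      show "integrable hborel (\<lambda>x::'f. ?P * (1 / (1 + l1norm x) ^ ?m))"
        by (intro integrable_mult_right integrable_l1norm_power)
      show "norm (pairing g \<psi> \<zeta>\<^sub>0 (\<zeta>\<^sub>0 + z *\<^sub>C v, x)) \<le> ?P * (1 / (1 + l1norm x) ^ ?m)" for x
        using C(2)[of "(\<zeta>\<^sub>0 + z *\<^sub>C v, x)"] M by simp
      show "0 \<le> ?P * (1 / (1 + l1norm x) ^ ?m)" for x :: 'f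
        using C(1) by simp
    qed
    also have "\<dots> = ?P * I"
      unfolding I_def by (rule integral_mult_right_zero)
    also have "\<dots> \<le> C * (b * (1 + norm z)) ^ n * exp ?M * I"
    proof -
      have "1 + norm (\<zeta>\<^sub>0 + z *\<^sub>C v) \<le> 1 + (norm \<zeta>\<^sub>0 + norm z * J)"
        using norm_triangle_ineq[of \<zeta>\<^sub>0 "z *\<^sub>C v"] J(2)[of z] by simp
      also have "\<dots> \<le> b * (1 + norm z)"
        using J(1) by (simp add: b_def algebra_simps)
      finally show ?thesis
        using C(1) I by (intro mult_right_mono mult_left_mono power_mono) auto
    qed
    finally show ?thesis
      by (simp add: power_mult_distrib mult_ac)
  qed
  have "((\<lambda>z::complex. C * b ^ n * I * ((1 + norm z) ^ n * exp (a * L * norm z - c * (norm z)\<^sup>2)))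
      \<longlongrightarrow> C * b ^ n * I * 0) at_infinity"
    by (intro tendsto_mult_left filterlim_compose[OF gaussian_decay[OF c(1)] filterlim_norm_at_top])
  then have lim: "((\<lambda>z::complex. C * b ^ n * I * ((1 + norm z) ^ n * exp (a * L * norm z - c * (norm z)\<^sup>2)))
      \<longlongrightarrow> 0) at_infinity"
    by (simp only: mult_zero_right)
  show ?thesis
    by (rule Lim_null_comparison[OF always_eventually lim]) (use bound in blast)
qed

section \<open>From vanishing on slices to the support\<close>

lemma integral_fl_eq_0:
  assumes g: "g \<in> O_space \<Phi> K" and A: "compact A" and \<psi>: "test_fun A \<psi>"
    and neg: "\<And>l. l \<in> A \<Longrightarrow> l \<bullet> Q v < 0"
  shows "(\<integral>x. g (\<zeta>, x) * fl \<psi> x 0 \<partial>hborel) = 0"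
proof -
  let ?H = "\<lambda>z. \<integral>x. pairing g \<psi> \<zeta> (\<zeta> + z *\<^sub>C v, x) \<partial>hborel"
  have "?H holomorphic_on UNIV"
    using pairing_integral_has_field_derivative[OF g A \<psi>] by (auto simp: holomorphic_on_open)
  then have "?H 0 = 0"
    using pairing_integral_tendsto_0[OF g A \<psi> neg] by (rule Liouville_weak)
  moreover have "0 *\<^sub>C v = 0"
    using linear_0[OF linear_scaleC_left] .
  \<comment> \<open>At \<open>z = 0\<close> the imaginary argument
    \<open>Q \<zeta> - Q \<zeta>\<close> is 0, so \<open>cr_test\<close> reduces to the ordinary
    Fourier transform.\<close>
  ultimately show ?thesis
    by (simp add: pairing_def cr_test_def)
qed

lemma partial_fourier_vanishes:
  assumes g: "g \<in> O_space \<Phi> K" and \<phi>: "smooth \<phi>" and comp: "compact (closure {p. \<phi> p \<noteq> 0})"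
    and supp: "closure {p. \<phi> p \<noteq> 0} \<subseteq> UNIV \<times> {\<xi>. blinfun_apply \<xi> (Q v) < 0}"
  shows "partial_fourier (fun_distribution g) \<phi> = 0"
proof -
  let ?S = "closure {p. \<phi> p \<noteq> 0}"
  let ?R = "\<lambda>\<xi>. \<Sum>b\<in>(onb::'f set). blinfun_apply \<xi> b *\<^sub>R b"
  \<comment> \<open>The Riesz representatives of the projected support: one compact set, inside the
    half space, for all slices \<open>\<zeta>\<close> at once.\<close>
  define A where "A = ?R ` snd ` ?S"
  have A: "compact A"
    unfolding A_def by (intro compact_continuous_image comp continuous_intros)
  have neg: "l \<bullet> Q v < 0" if "l \<in> A" for l
    using that supp by (auto simp: A_def blinfun_eq_inner_onb_sum)
  have test: "test_fun A (\<lambda>l. \<phi> (\<zeta>, blinfun_inner_right l))" for \<zeta>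
    unfolding test_fun_def
  proof (intro conjI allI impI)
    have "bounded_linear (\<lambda>l::'f. (0 :: 'e, blinfun_inner_right l))"
      by (intro bounded_linear_Pair bounded_linear_zero bounded_linear_blinfun_inner_right)
    from smooth_compose_affine[OF \<phi> this, of "(\<zeta>, 0)"]
    show "smooth (\<lambda>l. \<phi> (\<zeta>, blinfun_inner_right l))"
      by simp
    fix l :: 'f
    assume l: "l \<notin> A"
    have "(\<zeta>, blinfun_inner_right l) \<notin> ?S"
    proof (rule contrapos_nn[OF l])
      assume "(\<zeta>, blinfun_inner_right l) \<in> ?S"
      then have "?R (snd (\<zeta>, blinfun_inner_right l)) \<in> A"
        unfolding A_def by (intro imageI)
      then show "l \<in> A"
        by (simp add: onb_expansion)
    qed
    then have "(\<zeta>, blinfun_inner_right l) \<notin> {p. \<phi> p \<noteq> 0}"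
      by (rule contra_subsetD[OF closure_subset])
    then show "\<phi> (\<zeta>, blinfun_inner_right l) = 0"
      by simp
  qed
  interpret pair_sigma_finite "hborel :: 'e measure" "hborel :: 'f measure"
    by standard
  let ?f = "\<lambda>p. g p * partial_fourier_test \<phi> p"
  have "(\<integral>p. ?f p \<partial>(hborel \<Otimes>\<^sub>M hborel)) = 0"
  \<comment> \<open>In the integrable case Fubini reduces the integral to the slices, each of which
    vanishes; otherwise the Bochner integral is 0 by convention.\<close>
  proof (cases "integrable (hborel \<Otimes>\<^sub>M hborel) ?f")
    case True
    have "(\<integral>x. ?f (\<zeta>, x) \<partial>hborel) = 0" for \<zeta>
      using integral_fl_eq_0[OF g A test neg] by (simp add: partial_fourier_test_eq_fl[OF \<phi>])
    with integral_fst'[OF True] show ?thesis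
      by simp
  qed (rule not_integrable_integral_eq)
  then show ?thesis
    by (simp add: partial_fourier_def fun_distribution_def)
qed

text \<open>The complement of the polar cone is the union over \<open>v\<close> of the half spaces
  \<open>\<xi>(\<Phi>(v)) < 0\<close>, and each of them gives an open set on which the transform
  vanishes.\<close>

lemma partial_fourier_support:
  assumes g: "g \<in> O_space \<Phi> K"
  shows "distribution_support (partial_fourier (fun_distribution g)) \<subseteq> UNIV \<times> polar_cone \<Phi>"
proof
  fix p :: "'e \<times> ('f \<Rightarrow>\<^sub>L real)"
  assume p: "p \<in> distribution_support (partial_fourier (fun_distribution g))"
  have "0 \<le> blinfun_apply (snd p) (Q v)" for v
  proof (rule ccontr)
    let ?U = "UNIV \<times> {\<xi>. blinfun_apply \<xi> (Q v) < 0} :: ('e \<times> ('f \<Rightarrow>\<^sub>L real)) set"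
    assume "\<not> 0 \<le> blinfun_apply (snd p) (Q v)"
    then have "p \<in> ?U"
      by (auto simp: mem_Times_iff)
    moreover have "open ?U"
      by (intro open_Times open_UNIV open_Collect_less continuous_intros)
    ultimately have "p \<notin> distribution_support (partial_fourier (fun_distribution g))"
      unfolding distribution_support_def using partial_fourier_vanishes[OF g] by blast
    then show False
      using p by contradiction
  qed
  then show "p \<in> UNIV \<times> polar_cone \<Phi>"
    by (simp add: polar_cone_def mem_Times_iff)
qed

end

theorem proposition5p7:
  fixes \<Phi> :: "'e::fd_chilbert \<Rightarrow> 'e \<Rightarrow> 'f::fd_hilbert complexification"
    and K :: "('f \<Rightarrow>\<^sub>L real) set"
  assumes "hermitian_map \<Phi>"
    and "compact K"
    and "convex K"
  shows "O_space \<Phi> K = O_space \<Phi> (K \<inter> polar_cone \<Phi>)"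
proof
  interpret hermitian \<Phi>
    using assms(1) by unfold_locales
  \<comment> \<open>\<open>K\<close> enters \<open>O_space\<close> only through the inclusion of the
    support, which lies over \<open>polar_cone \<Phi>\<close> in any case.\<close>
  show "O_space \<Phi> K \<subseteq> O_space \<Phi> (K \<inter> polar_cone \<Phi>)"
  proof
    fix g
    assume g: "g \<in> O_space \<Phi> K"
    then show "g \<in> O_space \<Phi> (K \<inter> polar_cone \<Phi>)"
      using partial_fourier_support[OF g] by (auto simp: O_space_def)
  qed
  show "O_space \<Phi> (K \<inter> polar_cone \<Phi>) \<subseteq> O_space \<Phi> K"
    by (auto simp: O_space_def)
qed

end
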